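(* For $n,k\ge 1$, the number $r_0(n,k)$ of reduced partitions of genus $1$ of the set $\{1,\dots,n\}$ having $k$ blocks is $$r_0(n,k)=\binom{n}{2k}\binom{k+1}{3}.$$ Moreover $$R_0(x,y)=\sum_{n,k}r_0(n,k)x^ny^k=\frac{y^2x^4(1-x)^3}{\bigl((1-x)^2-yx^2\bigr)^4}.$$
   Context: Permutations are composed right to left; $\zeta_n=(1,\dots,n)$; $z(\pi)$ is the number of cycles; the genus of $\alpha\in S_n$ is defined by $n+1-2g(\alpha)=z(\alpha)+z(\alpha^{-1}\zeta_n)$. A partition of $\{1,\dots,n\}$ is identified with the permutation whose cycles are its blocks written in increasing order; its genus is that of this permutation. A trivial cycle is a cycle $(i,i+1,\dots,i+p)$ with entries modulo $n$ (fixed points included); a partition is reduced if its permutation has no trivial cycle. *)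

theory Defs
  imports
    "HOL-Combinatorics.Combinatorics"
    "HOL-Library.Disjoint_Sets"
    "HOL-Computational_Algebra.Formal_Power_Series"
begin

text \<open>
  Permutations of \<open>{1..n}\<close> are functions on \<open>nat\<close> that fix everything outside \<open>{1..n}\<close>, and
  \<open>\<circ>\<close> composes them right to left.
\<close>

text \<open>Fixed points count as cycles: the orbit of a fixed point \<open>i\<close> is \<open>{i}\<close>.\<close>

definition num_cycles :: "nat \<Rightarrow> (nat \<Rightarrow> nat) \<Rightarrow> nat" where
  "num_cycles n \<pi> = card (orbit \<pi> ` {1..n})"

definition zeta :: "nat \<Rightarrow> nat \<Rightarrow> nat" where
  "zeta n = cycle_of_list [1..<Suc n]"

text \<open>
  This solves \<open>n + 1 - 2 g = z(\<alpha>) + z(\<alpha>\<^sup>-\<^sup>1 \<zeta>\<^sub>n)\<close> for \<open>g\<close>. The value is rational so that neither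
  subtraction nor halving is truncated.
\<close>

definition genus :: "nat \<Rightarrow> (nat \<Rightarrow> nat) \<Rightarrow> rat" where
  "genus n \<alpha> =
    (of_nat n + 1 - of_nat (num_cycles n \<alpha>) - of_nat (num_cycles n (inv \<alpha> \<circ> zeta n))) / 2"

definition perm_of_partition :: "nat set set \<Rightarrow> nat \<Rightarrow> nat" where
  "perm_of_partition P i =
    (if i \<in> \<Union>P then cycle_of_list (sorted_list_of_set (THE B. B \<in> P \<and> i \<in> B)) i else i)"

definition is_cycle_of :: "nat list \<Rightarrow> (nat \<Rightarrow> nat) \<Rightarrow> bool" where
  "is_cycle_of cs \<pi> \<longleftrightarrow> cs \<noteq> [] \<and> distinct cs \<and> (\<forall>x \<in> set cs. \<pi> x = cycle_of_list cs x)"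

text \<open>
  The cyclic sequence \<open>(i, i + 1, \<dots>, i + p)\<close>, whose entries are reduced modulo \<open>n\<close> to
  representatives in \<open>{1..n}\<close>. The bound \<open>p < n\<close> makes them distinct; \<open>p = 0\<close> gives a fixed point.
\<close>

definition trivial_cycle :: "nat \<Rightarrow> nat list \<Rightarrow> bool" where
  "trivial_cycle n cs \<longleftrightarrow>
    (\<exists>i \<in> {1..n}. \<exists>p < n. cs = map (\<lambda>j. (i + j - 1) mod n + 1) [0..<Suc p])"

definition reduced_partition :: "nat \<Rightarrow> nat set set \<Rightarrow> bool" where
  "reduced_partition n P \<longleftrightarrow>
    \<not> (\<exists>cs. is_cycle_of cs (perm_of_partition P) \<and> trivial_cycle n cs)"

definition r0 :: "nat \<Rightarrow> nat \<Rightarrow> nat" where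
  "r0 n k = card {P. partition_on {1..n} P \<and> card P = k \<and>
    genus n (perm_of_partition P) = 1 \<and> reduced_partition n P}"

text \<open>
  Formal power series in \<open>x\<close> and \<open>y\<close> are represented as series in \<open>x\<close> whose coefficients are
  series in \<open>y\<close>. Division by a series with constant term \<open>1\<close> in \<open>x\<close> is then multiplication by its
  inverse, although the coefficients do not form a field.
\<close>

abbreviation var_x :: "rat fps fps" where "var_x \<equiv> fps_X"

abbreviation var_y :: "rat fps fps" where "var_y \<equiv> fps_const fps_X"

text \<open>
  Starting the sum at \<open>n = 0\<close> or \<open>n = 1\<close>, and \<open>k = 0\<close> or \<open>k = 1\<close>, makes no difference:
  the only partition with \<open>n = 0\<close> or \<open>k = 0\<close> is that of the empty set, whose genus
  by the formula above is \<open>1/2\<close>.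
\<close>

definition R0 :: "rat fps fps" where
  "R0 = Abs_fps (\<lambda>n. Abs_fps (\<lambda>k. of_nat (r0 n k)))"

end

theory Submission
  imports Defs
begin

text \<open>
  Let \<open>\<alpha>\<close> be the permutation of a partition and \<open>\<beta> = \<alpha>\<^sup>-\<^sup>1 \<zeta>\<^sub>n\<close>. The fixed points of \<open>\<beta>\<close> are the
  \<open>i\<close> with \<open>\<alpha> i = \<zeta>\<^sub>n i\<close>. Contracting every such \<open>i\<close> into its successor preserves genus and
  number of blocks, and a reduced partition is recovered from its contraction and the set \<open>F\<close> of
  the remaining points. It thus suffices to count the contracted partitions, in which all cycles
  of \<open>\<alpha>\<close> and \<open>\<beta>\<close> have length at least 2. In genus 1 the excess of the cycle lengths of \<open>\<alpha>\<close> and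
  \<open>\<beta>\<close> over 2 sums to 2. Since \<open>\<alpha>\<close> increases along its cycles, following parallel arcs inwards
  shows that every arc of a block contains some of this excess, which forces all blocks to have
  size 2, so \<open>|F| = 2k\<close>. Then \<open>\<beta>\<close> has, besides 2-cycles, one 4-cycle or two 3-cycles, and the
  matching consists of two or three classes of parallel chords, any two of which cross. Cutting
  the cycle at 1 splits one class into two, and these matchings are parametrised by the \<open>(k + 1)
  choose 3\<close> solutions of \<open>u + q + r + s = k\<close> with \<open>u, q \<ge> 1\<close>.

  For the generating function, multiplying \<open>\<Sum> (n choose 2k) c\<^sub>k x\<^sup>n y\<^sup>k\<close> by \<open>(1 - x)\<^sup>2 - y x\<^sup>2\<close>
  amounts to differencing the sequence \<open>c\<close>.
\<close>

section \<open>Permutations of partitions\<close>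

lemma cycle_of_list_nth:
  assumes "distinct xs" "t < length xs"
  shows "cycle_of_list xs (xs ! t) = xs ! (Suc t mod length xs)"
proof -
  have "map (cycle_of_list xs) xs = rotate1 xs"
    using cyclic_rotation[OF assms(1), of 1] by simp
  then have "cycle_of_list xs (xs ! t) = rotate1 xs ! t"
    using assms(2) by (metis nth_map)
  then show ?thesis using assms(2) by (simp add: nth_rotate1)
qed

section \<open>The long cycle and its arcs\<close>

lemma zeta_apply:
  assumes "i \<in> {1..n}"
  shows "zeta n i = (if i = n then 1 else Suc i)"
proof -
  have "cycle_of_list [1..<Suc n] ([1..<Suc n] ! (i - 1)) =
      [1..<Suc n] ! (Suc (i - 1) mod length [1..<Suc n])"
    using assms by (intro cycle_of_list_nth) auto
  moreover have "[1..<Suc n] ! (i - 1) = i" using assms by (subst nth_upt) auto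
  moreover have "[1..<Suc n] ! (Suc (i - 1) mod length [1..<Suc n]) = (if i = n then 1 else Suc i)"
    using assms by (subst nth_upt) (auto simp del: upt_Suc)
  ultimately show ?thesis by (simp add: zeta_def del: upt_Suc)
qed

lemma zeta_permutes: "zeta n permutes {1..n}"
  using cycle_permutes[of "[1..<Suc n]"]
    by (simp add: zeta_def atLeastLessThanSuc_atLeastAtMost del: upt_Suc)

lemma zeta_in: "i \<in> {1..n} \<Longrightarrow> zeta n i \<in> {1..n}"
  by (simp only: permutes_in_image[OF zeta_permutes])

lemma zeta_inject: "zeta n i = zeta n j \<longleftrightarrow> i = j"
  using permutes_inj[OF zeta_permutes] by (meson injD)

definition zeta_pred :: "nat \<Rightarrow> nat \<Rightarrow> nat" where
  "zeta_pred n i = (if i = 1 then n else i - 1)"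

lemma zeta_pred_in: "i \<in> {1..n} \<Longrightarrow> zeta_pred n i \<in> {1..n}"
  by (auto simp: zeta_pred_def)

lemma zeta_zeta_pred: "i \<in> {1..n} \<Longrightarrow> zeta n (zeta_pred n i) = i"
  by (subst zeta_apply) (auto simp: zeta_pred_def)

lemma zeta_pred_zeta: "i \<in> {1..n} \<Longrightarrow> zeta_pred n (zeta n i) = i"
  by (auto simp: zeta_apply zeta_pred_def)

text \<open>The open arc from \<open>x\<close> to \<open>y\<close> along \<open>zeta n\<close>. For
  \<open>x = y\<close> it consists of all points except \<open>x\<close>, so that gap conditions
  also make sense for blocks of size one.\<close>

definition cyc_gap :: "nat \<Rightarrow> nat \<Rightarrow> nat \<Rightarrow> nat set" where
  "cyc_gap n x y = {z \<in> {1..n}. if x < y then x < z \<and> z < y else x < z \<or> z < y}"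

lemma zeta_funpow:
  assumes "i \<in> {1..n}"
  shows "(zeta n ^^ t) i = (i + t - 1) mod n + 1"
proof (induction t)
  case 0
  then show ?case using assms by (cases i) auto
next
  case (Suc t)
  have "(i + t - 1) mod n < n" using assms by (intro mod_less_divisor) auto
  then have "(i + t - 1) mod n + 1 \<in> {1..n}" by simp
  then have "zeta n ((i + t - 1) mod n + 1) = ((i + t - 1) mod n + 1) mod n + 1"
    by (auto simp: zeta_apply)
  also have "\<dots> = (i + Suc t - 1) mod n + 1" using assms by (simp add: mod_Suc_eq)
  finally show ?case using Suc by simp
qed

lemma zeta_funpow_less:
  assumes "i \<in> {1..n}" "t < n"
  shows "(zeta n ^^ t) i = (if i + t \<le> n then i + t else i + t - n)"
  using assms unfolding zeta_funpow[OF assms(1)] by (auto simp: le_mod_geq)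

lemma zeta_funpow_in: "i \<in> {1..n} \<Longrightarrow> (zeta n ^^ t) i \<in> {1..n}"
  by (induction t) (simp_all only: funpow.simps comp_apply id_apply zeta_in)

lemma zeta_funpow_neq:
  assumes "i \<in> {1..n}" "0 < t" "t < n"
  shows "(zeta n ^^ t) i \<noteq> i"
  using assms by (auto simp: zeta_funpow_less)

lemma zeta_funpow_reach:
  assumes "i \<in> {1..n}" "j \<in> {1..n}" "i \<noteq> j"
  obtains t where "0 < t" "t < n" "(zeta n ^^ t) i = j"
    "\<And>s. 0 < s \<Longrightarrow> s < t \<Longrightarrow> (zeta n ^^ s) i \<in> cyc_gap n i j"
proof -
  define t where "t = (if i < j then j - i else n + j - i)"
  have t: "0 < t" "t < n" using assms by (auto simp: t_def)
  show ?thesis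
  proof (rule that[OF t])
    show "(zeta n ^^ t) i = j" using assms zeta_funpow_less[OF assms(1) t(2)] by (auto simp: t_def)
    show "(zeta n ^^ s) i \<in> cyc_gap n i j" if "0 < s" "s < t" for s
    proof -
      have "s < n" using that t by simp
      then show ?thesis
        using that assms zeta_funpow_less[OF assms(1), of s]
        by (auto simp: t_def cyc_gap_def split: if_splits)
    qed
  qed
qed

section \<open>The cyclic successor within a block\<close>

lemma block_unique:
  assumes "partition_on A P" "B \<in> P" "C \<in> P" "i \<in> B" "i \<in> C"
  shows "B = C"
  using assms partition_onD2[OF assms(1)] by (auto simp: disjoint_def)

lemma block_exists:
  assumes "partition_on A P" "i \<in> A"
  obtains B where "B \<in> P" "i \<in> B"
  using assms by (auto simp: partition_on_def)

lemma block_subset: "partition_on A P \<Longrightarrow> B \<in> P \<Longrightarrow> B \<subseteq> A"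
  by (auto simp: partition_on_def)

text \<open>Together with \<open>perm_of_partition_eqI\<close> this characterises \<alpha> i as the
  cyclically next point of the block, and replaces the list definition in all later
  arguments.\<close>

lemma perm_of_partition_next:
  assumes P: "partition_on {1..n} P" and B: "B \<in> P" and i: "i \<in> B"
  shows "perm_of_partition P i \<in> B"
    and "B \<inter> cyc_gap n i (perm_of_partition P i) = {}"
proof -
  define xs where "xs = sorted_list_of_set B"
  have fin: "finite B" using block_subset[OF P B] finite_subset by blast
  have xs: "set xs = B" "distinct xs" "sorted xs"
    using fin by (auto simp: xs_def)
  have "(THE C. C \<in> P \<and> i \<in> C) = B"
    using block_unique[OF P] B i by (intro the_equality) blast+
  then have al: "perm_of_partition P i = cycle_of_list xs i"
    using B i by (auto simp: perm_of_partition_def xs_def)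
  obtain t where t: "t < length xs" "xs ! t = i" using i xs by (metis in_set_conv_nth)
  have al': "perm_of_partition P i = xs ! (Suc t mod length xs)"
    using cycle_of_list_nth[OF xs(2) t(1)] t(2) al by simp
  show "perm_of_partition P i \<in> B" unfolding al' xs(1)[symmetric]
    by (rule nth_mem) (use t in \<open>auto intro: mod_less_divisor\<close>)
  have less: "xs ! a < xs ! b \<longleftrightarrow> a < b" if "a < length xs" "b < length xs" for a b
    using that xs(2,3)
      by (metis linorder_neqE_nat not_less_iff_gr_or_eq sorted_wrt_nth_less strict_sorted_iff)
  show "B \<inter> cyc_gap n i (perm_of_partition P i) = {}"
  proof (rule ccontr)
    assume "B \<inter> cyc_gap n i (perm_of_partition P i) \<noteq> {}"
    then obtain z where z: "z \<in> B" "z \<in> cyc_gap n i (perm_of_partition P i)" by blast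
    obtain s where s: "s < length xs" "xs ! s = z" using z(1) xs by (metis in_set_conv_nth)
    show False
    proof (cases "Suc t < length xs")
      case True
      then have "perm_of_partition P i = xs ! Suc t" by (simp add: al')
      then show False using z(2) less[OF t(1) s(1)] less[OF s(1) True] less[OF t(1) True] t s
        by (auto simp: cyc_gap_def split: if_splits)
    next
      case False
      then have len: "length xs = Suc t" using t by simp
      then have eq: "perm_of_partition P i = xs ! 0" by (simp add: al')
      show False using z(2) less[OF t(1) s(1)] less[OF s(1), of 0] less[OF t(1), of 0] t s len eq
        by (auto simp: cyc_gap_def split: if_splits)
    qed
  qed
qed

text \<open>Both \<open>y\<close> and \<alpha> i lie in the block and have an empty gap from
  \<open>i\<close>, so neither comes before the other on the way round from
  \<open>i\<close>.\<close>

lemma perm_of_partition_eqI: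
  assumes P: "partition_on {1..n} P" and B: "B \<in> P" "i \<in> B" "y \<in> B"
    and gap: "B \<inter> cyc_gap n i y = {}"
  shows "perm_of_partition P i = y"
proof -
  define a where "a = perm_of_partition P i"
  have a: "a \<in> B" "B \<inter> cyc_gap n i a = {}"
    using perm_of_partition_next[OF P B(1,2)] by (auto simp: a_def)
  have "B \<subseteq> {1..n}" using block_subset[OF P B(1)] .
  then have "y \<in> {1..n}" "a \<in> {1..n}" using B a by auto
  moreover have "y \<notin> cyc_gap n i a" "a \<notin> cyc_gap n i y" using a gap B by auto
  ultimately have "a = y" by (auto simp: cyc_gap_def split: if_splits)
  then show ?thesis by (simp add: a_def)
qed

lemma perm_of_partition_permutes:
  assumes P: "partition_on {1..n} P"
  shows "perm_of_partition P permutes {1..n}"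
proof (rule bij_imp_permutes)
  have "inj_on (perm_of_partition P) {1..n}"
  proof (rule inj_onI)
    fix i j assume ij: "i \<in> {1..n}" "j \<in> {1..n}" "perm_of_partition P i = perm_of_partition P j"
    obtain B where B: "B \<in> P" "i \<in> B" using block_exists[OF P ij(1)] .
    obtain C where C: "C \<in> P" "j \<in> C" using block_exists[OF P ij(2)] .
    note b = perm_of_partition_next[OF P B] and c = perm_of_partition_next[OF P C]
    have "B = C" using block_unique[OF P B(1) C(1)] b c ij by metis
    \<comment> \<open>Each of two points with a common successor lies outside the arc from the other
      one to that successor.\<close>
    then have "j \<notin> cyc_gap n i (perm_of_partition P i)" "i \<notin> cyc_gap n j (perm_of_partition P i)"
      using b c B C ij by auto
    then show "i = j" using ij(1,2) by (auto simp: cyc_gap_def split: if_splits)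
  qed
  moreover have "perm_of_partition P ` {1..n} \<subseteq> {1..n}"
  proof
    fix y assume "y \<in> perm_of_partition P ` {1..n}"
    then obtain i where i: "i \<in> {1..n}" "y = perm_of_partition P i" by blast
    obtain B where B: "B \<in> P" "i \<in> B" using block_exists[OF P i(1)] .
    then show "y \<in> {1..n}" using perm_of_partition_next(1)[OF P B] block_subset[OF P B(1)] i by auto
  qed
  ultimately show "bij_betw (perm_of_partition P) {1..n} {1..n}"
    by (simp add: bij_betw_def endo_inj_surj)
  show "perm_of_partition P i = i" if "i \<notin> {1..n}" for i
    using that partition_onD1[OF P] by (auto simp: perm_of_partition_def)
qed

text \<open>This is the \<beta> whose cycles enter the genus. For a noncrossing partition it is the
  permutation of the Kreweras complement.\<close>

definition kreweras :: "nat \<Rightarrow> nat set set \<Rightarrow> nat \<Rightarrow> nat" where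
  "kreweras n P = inv (perm_of_partition P) \<circ> zeta n"

context
  fixes n :: nat and P :: "nat set set"
  assumes P: "partition_on {1..n} P"
begin

lemma perm_in: "i \<in> {1..n} \<Longrightarrow> perm_of_partition P i \<in> {1..n}"
  by (simp only: permutes_in_image[OF perm_of_partition_permutes[OF P]])

lemma perm_inject: "perm_of_partition P i = perm_of_partition P j \<longleftrightarrow> i = j"
  using permutes_inj[OF perm_of_partition_permutes[OF P]] by (meson injD)

lemma kreweras_permutes: "kreweras n P permutes {1..n}"
  unfolding kreweras_def
  by (intro permutes_compose zeta_permutes permutes_inv perm_of_partition_permutes[OF P])

lemma kreweras_in: "i \<in> {1..n} \<Longrightarrow> kreweras n P i \<in> {1..n}"
  by (simp only: permutes_in_image[OF kreweras_permutes])

lemma perm_kreweras: "perm_of_partition P (kreweras n P i) = zeta n i"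
  using permutes_inverses(1)[OF perm_of_partition_permutes[OF P]] by (simp add: kreweras_def)

lemma kreweras_eq_iff: "kreweras n P i = j \<longleftrightarrow> perm_of_partition P j = zeta n i"
  using perm_kreweras perm_inject by metis

lemma kreweras_inject: "kreweras n P i = kreweras n P j \<longleftrightarrow> i = j"
  using permutes_inj[OF kreweras_permutes] by (meson injD)

end

section \<open>Excess of cycle lengths\<close>

text \<open>Since \<beta> i = i means \<alpha> i = \<open>zeta n i\<close>, the two inequalities
  exclude fixed points of \<alpha> and of \<beta>. These are the contracted partitions.\<close>

definition fully_reduced :: "nat \<Rightarrow> nat set set \<Rightarrow> bool" where
  "fully_reduced n P \<longleftrightarrow>
    (\<forall>i \<in> {1..n}. perm_of_partition P i \<noteq> i \<and> perm_of_partition P i \<noteq> zeta n i)"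

lemma partition_on_orbits:
  assumes f: "f permutes A" and A: "finite A"
  shows "partition_on A (orbit f ` A)"
proof (rule partition_onI)
  have perm: "permutation f" using f A by (auto simp: permutation_permutes)
  have self: "i \<in> orbit f i" for i using permutation_self_in_orbit[OF perm] .
  show "\<Union> (orbit f ` A) = A" using permutes_orbit_subset[OF f] self by blast
  show "{} \<notin> orbit f ` A" using orbit_nonempty by fastforce
  show "disjnt p q" if pq: "p \<in> orbit f ` A" "q \<in> orbit f ` A" "p \<noteq> q" for p q
  proof -
    obtain i where i: "p = orbit f i" using pq(1) by blast
    obtain j where j: "q = orbit f j" using pq(2) by blast
    have "orbit f c = orbit f d" if "c \<in> orbit f d" for c d
      using that self by (meson orbit_swap orbit_trans subsetI subset_antisym)
    then show ?thesis using pq(3) unfolding i j disjnt_def by blast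
  qed
qed

lemma orbit_card_ge_2:
  assumes "f permutes A" "finite A" "\<And>i. i \<in> A \<Longrightarrow> f i \<noteq> i" "C \<in> orbit f ` A"
  shows "2 \<le> card C"
proof -
  obtain i where i: "i \<in> A" "C = orbit f i" using assms(4) by blast
  have perm: "permutation f" using assms(1,2) by (auto simp: permutation_permutes)
  have "{i, f i} \<subseteq> C" "f i \<noteq> i"
    using i assms(3) permutation_self_in_orbit[OF perm] orbit.base by fastforce+
  moreover have "finite C" using i permutes_orbit_subset[OF assms(1) i(1)] assms(2) finite_subset
      by blast
  ultimately show ?thesis by (metis card_2_iff card_mono)
qed

lemma orbit_eq_image:
  assumes "(f ^^ m) x = x" "0 < m"
  shows "orbit f x = (\<lambda>t. (f ^^ t) x) ` {..<m}"
  using orbit_altdef_bounded[OF assms] by auto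

text \<open>By \<open>two\<close> the truncated subtraction is exact. The identity serves the blocks
  of \<alpha> and the orbits of \<beta> alike.\<close>

lemma sum_card_partition_excess:
  assumes P: "partition_on A P" and A: "finite A" and two: "\<And>B. B \<in> P \<Longrightarrow> 2 \<le> card B"
  shows "(\<Sum>B\<in>P. card B - 2) + 2 * card P = card A"
proof -
  have fin: "finite P" using finite_elements[OF A P] .
  have "card A = (\<Sum>B\<in>P. card B)"
    using partition_onD1[OF P] partition_onD2[OF P] A
    by (metis card_Union_disjoint disjoint_def disjnt_def finite_subset Sup_upper pairwise_def)
  also have "\<dots> = (\<Sum>B\<in>P. (card B - 2) + 2)"
    by (intro sum.cong refl) (use two in \<open>metis le_add_diff_inverse2\<close>)
  also have "\<dots> = (\<Sum>B\<in>P. card B - 2) + 2 * card P"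
    by (simp only: sum.distrib sum_constant) simp
  finally show ?thesis by simp
qed

text \<open>If the orbit missed a point \<open>c\<close> of the block, take its largest point below
  \<open>c\<close>, or its maximum if there is none. The successor of that point would jump over
  \<open>c\<close>, against the empty gap.\<close>

lemma orbit_perm_of_partition:
  assumes P: "partition_on {1..n} P" and B: "B \<in> P" "i \<in> B"
  shows "orbit (perm_of_partition P) i = B"
proof
  define Q where "Q = orbit (perm_of_partition P) i"
  have Bn: "B \<subseteq> {1..n}" using block_subset[OF P B(1)] .
  show sub: "orbit (perm_of_partition P) i \<subseteq> B"
  proof
    fix c assume "c \<in> orbit (perm_of_partition P) i"
    then show "c \<in> B" by induction (use perm_of_partition_next(1)[OF P B(1)] B in auto)
  qed
  have closed: "perm_of_partition P c \<in> Q" if "c \<in> Q" for c using that orbit.step by (metis Q_def)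
  have fin: "finite Q" unfolding Q_def using sub Bn by (meson finite_atLeastAtMost finite_subset)
  have "Q \<noteq> {}" unfolding Q_def by (rule orbit_nonempty)
  note fin = fin this
  show "B \<subseteq> orbit (perm_of_partition P) i"
  proof
    fix c assume c: "c \<in> B"
    show "c \<in> orbit (perm_of_partition P) i"
    proof (rule ccontr)
      assume "c \<notin> orbit (perm_of_partition P) i"
      then have cQ: "c \<notin> Q" by (simp add: Q_def)
      have no: "c \<notin> cyc_gap n d (perm_of_partition P d)" if "d \<in> Q" for d
        using perm_of_partition_next(2)[OF P B(1), of d] that sub c by (auto simp: Q_def)
      have cn: "c \<in> {1..n}" using c Bn by blast
      show False
      proof (cases "\<exists>d \<in> Q. d < c")
        case True
        define d where "d = Max {d \<in> Q. d < c}"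
        have "d \<in> {d \<in> Q. d < c}" unfolding d_def using True fin by (intro Max_in) auto
        then have d: "d \<in> Q" "d < c" by auto
        have "e \<le> d" if "e \<in> Q" "e < c" for e unfolding d_def using that fin by (intro Max_ge) auto
        then show False using no[OF d(1)] closed[OF d(1)] d cQ cn
          by (fastforce simp: cyc_gap_def split: if_splits)
      next
        case False
        define d where "d = Max Q"
        have d: "d \<in> Q" unfolding d_def using fin by (intro Max_in) auto
        have "e \<le> d" if "e \<in> Q" for e unfolding d_def using that fin by (intro Max_ge) auto
        then have "perm_of_partition P d \<le> d" using closed d by blast
        moreover have "c < perm_of_partition P d"
          using False closed[OF d] cQ by (metis linorder_neqE_nat)
        ultimately show False using no[OF d] cn by (auto simp: cyc_gap_def)
      qed
    qed
  qed
qed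

lemma partition_eq_orbits:
  assumes "partition_on {1..n} P"
  shows "P = orbit (perm_of_partition P) ` {1..n}"
proof (intro equalityI subsetI)
  fix B assume B: "B \<in> P"
  then obtain i where i: "i \<in> B" using partition_onD3[OF assms] by (metis ex_in_conv)
  then show "B \<in> orbit (perm_of_partition P) ` {1..n}"
    using orbit_perm_of_partition[OF assms B i] block_subset[OF assms B] by blast
next
  fix B assume "B \<in> orbit (perm_of_partition P) ` {1..n}"
  then obtain i where i: "i \<in> {1..n}" "B = orbit (perm_of_partition P) i" by blast
  obtain C where "C \<in> P" "i \<in> C" using block_exists[OF assms i(1)] .
  then show "B \<in> P" using orbit_perm_of_partition[OF assms] i by metis
qed

lemma num_cycles_perm_of_partition:
  "partition_on {1..n} P \<Longrightarrow> num_cycles n (perm_of_partition P) = card P"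
  unfolding num_cycles_def by (rule arg_cong[where f = card, OF partition_eq_orbits, symmetric])

context
  fixes n :: nat and P :: "nat set set"
  assumes P: "partition_on {1..n} P" and fr: "fully_reduced n P"
begin

lemma kreweras_neq: "i \<in> {1..n} \<Longrightarrow> kreweras n P i \<noteq> i"
  using fr perm_kreweras[OF P] by (metis fully_reduced_def)

lemma block_card_ge_2:
  assumes "B \<in> P"
  shows "2 \<le> card B"
proof -
  obtain i where i: "i \<in> B" using assms partition_onD3[OF P] by (metis ex_in_conv)
  have B: "B \<subseteq> {1..n}" using block_subset[OF P assms] .
  have "{i, perm_of_partition P i} \<subseteq> B" "perm_of_partition P i \<noteq> i"
    using i B perm_of_partition_next(1)[OF P assms i] fr by (auto simp: fully_reduced_def)
  then show ?thesis
    by (metis B card_2_iff card_mono finite_atLeastAtMost finite_subset)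
qed

text \<open>Parallel chords inside an arc are peeled off one by one until something else is met.\<close>

lemma arc_contains_excess:
  assumes "x \<in> {1..n}"
  defines "y \<equiv> perm_of_partition P x"
  shows "(\<exists>C \<in> P. C \<subseteq> cyc_gap n x y \<and> 3 \<le> card C) \<or>
    (\<exists>z \<in> insert x (cyc_gap n x y). \<exists>w \<in> insert x (cyc_gap n x y).
      z \<noteq> w \<and> kreweras n P z = w \<and> kreweras n P w \<noteq> z)"
  using assms(1) unfolding y_def
proof (induction "card (cyc_gap n x (perm_of_partition P x))" arbitrary: x rule: less_induct)
  case less
  define y where "y = perm_of_partition P x"
  define z where "z = zeta_pred n y"
  have y: "y \<in> {1..n}" "y \<noteq> x" "y \<noteq> zeta n x"
    using less.prems perm_in[OF P] fr by (auto simp: y_def fully_reduced_def)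
  have z: "z \<in> {1..n}" "zeta n z = y" using zeta_pred_in zeta_zeta_pred y by (auto simp: z_def)
  have zx: "z \<noteq> x" using z y by blast
  have zy: "y = (if z = n then 1 else Suc z)" using z zeta_apply by metis
  have zetax: "zeta n x = (if x = n then 1 else Suc x)" "zeta n x \<in> {1..n}"
    using less.prems zeta_apply zeta_in by blast+
  have bz: "kreweras n P z = x" unfolding kreweras_eq_iff[OF P] z(2) y_def ..
  have zgap: "z \<in> cyc_gap n x y"
    using z(1) zx zy y less.prems zetax by (auto simp: cyc_gap_def split: if_splits)
  \<comment> \<open>\<beta> sends \<open>z\<close>, the point before \<open>y\<close>, to
    \<open>x\<close>. Either \<beta> does not send \<open>x\<close> back, and \<open>z\<close>,
    \<open>x\<close> is the required pair, or \<alpha> z = \<open>zeta n x\<close>, which confines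
    the block of \<open>z\<close> to the inside of the arc.\<close>
  show ?case
  proof (cases "kreweras n P x = z")
    case False
    then show ?thesis using bz zgap zx unfolding y_def by blast
  next
    case True
    then have az: "perm_of_partition P z = zeta n x" using kreweras_eq_iff[OF P] by blast
    obtain C where C: "C \<in> P" "z \<in> C" using block_exists[OF P z(1)] .
    note next_z = perm_of_partition_next[OF P C, unfolded az]
    have sub: "C \<subseteq> cyc_gap n x y"
    proof
      fix c assume "c \<in> C"
      then have "c \<in> {1..n}" "c \<notin> cyc_gap n z (zeta n x)"
        using block_subset[OF P C(1)] next_z by blast+
      then show "c \<in> cyc_gap n x y"
        using z(1) zx zy y less.prems zetax by (auto simp: cyc_gap_def split: if_splits)
    qed
    show ?thesis
    proof (cases "3 \<le> card C")
      case True
      then show ?thesis using sub C unfolding y_def by blast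
    next
      case False
      \<comment> \<open>The block of \<open>z\<close> is now a chord parallel to the arc from
        \<open>x\<close> to \<open>y\<close>, and the induction continues with the smaller arc from
        \<open>zeta n x\<close> to \<open>z\<close>.\<close>
      then have card2: "card C = 2" using block_card_ge_2[OF C(1)] by simp
      have ne: "zeta n x \<noteq> z" using fr az z(1) by (metis fully_reduced_def)
      have Ceq: "C = {z, zeta n x}"
      proof (rule card_subset_eq[symmetric])
        show "finite C" using card2 by (intro card_ge_0_finite) simp
        show "{z, zeta n x} \<subseteq> C" using C(2) next_z(1) by simp
        show "card {z, zeta n x} = card C" using card2 ne by simp
      qed
      have "perm_of_partition P (zeta n x) \<in> C" "perm_of_partition P (zeta n x) \<noteq> zeta n x"
        using perm_of_partition_next(1)[OF P C(1) next_z(1)] fr zetax(2)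
        unfolding fully_reduced_def by blast+
      then have a: "perm_of_partition P (zeta n x) = z" using Ceq by blast
      have sub': "insert (zeta n x) (cyc_gap n (zeta n x) z) \<subseteq> cyc_gap n x y"
      proof -
        have "cyc_gap n (zeta n x) z \<subseteq> cyc_gap n x y"
          using z(1) zx zy y less.prems zetax ne by (auto simp: cyc_gap_def split: if_splits)
        then show ?thesis using sub Ceq by blast
      qed
      have "zeta n x \<notin> cyc_gap n (zeta n x) z"
        using z(1) zetax ne by (auto simp: cyc_gap_def)
      then have smaller: "card (cyc_gap n (zeta n x) z) < card (cyc_gap n x y)"
      proof (intro psubset_card_mono)
        show "finite (cyc_gap n x y)" by (simp add: cyc_gap_def)
      qed (use sub' in blast)
      from less.hyps[OF smaller[folded a, unfolded y_def] zetax(2), unfolded a]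
      show ?thesis using sub' unfolding y_def by blast
    qed
  qed
qed

text \<open>The points of a block cut the cycle into half-open arcs. Disjointness ensures that
  excess found in two arcs is not located at the same points.\<close>

lemma arcs_disjoint:
  assumes B: "B \<in> P" "x \<in> B" "x' \<in> B" "x \<noteq> x'"
  shows "insert x (cyc_gap n x (perm_of_partition P x)) \<inter>
    insert x' (cyc_gap n x' (perm_of_partition P x')) = {}"
proof -
  define y where "y = perm_of_partition P x"
  define y' where "y' = perm_of_partition P x'"
  have n: "y \<in> B" "B \<inter> cyc_gap n x y = {}" "y' \<in> B" "B \<inter> cyc_gap n x' y' = {}"
    using perm_of_partition_next[OF P B(1)] B by (auto simp: y_def y'_def)
  have "y \<noteq> y'" using perm_inject[OF P] B(4) by (simp add: y_def y'_def)
  moreover have "{x, x', y, y'} \<subseteq> {1..n}" using n B block_subset[OF P B(1)] by blast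
  moreover have "x' \<notin> cyc_gap n x y" "y' \<notin> cyc_gap n x y" "x \<notin> cyc_gap n x' y'"
      "y \<notin> cyc_gap n x' y'"
    using n B by blast+
  ultimately have "insert x (cyc_gap n x y) \<inter> insert x' (cyc_gap n x' y') = {}"
    using B(4) by (auto simp: cyc_gap_def split: if_splits)
  then show ?thesis by (simp add: y_def y'_def)
qed

lemma genus_one_card:
  assumes "genus n (perm_of_partition P) = 1"
  shows "card P + card (orbit (kreweras n P) ` {1..n}) + 1 = n"
proof -
  have "(of_nat n :: rat) + 1 - of_nat (card P) -
      of_nat (card (orbit (kreweras n P) ` {1..n})) = 2"
    using assms num_cycles_perm_of_partition[OF P]
      by (simp add: genus_def num_cycles_def kreweras_def)
  then have "(of_nat (card P + card (orbit (kreweras n P) ` {1..n}) + 1) :: rat) = of_nat n"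
    by simp
  then show ?thesis using of_nat_eq_iff by blast
qed

text \<open>The two excesses are \<open>n\<close> minus twice the number of cycles of \<alpha> and
  of \<beta>. In genus 1 there are \<open>n - 1\<close> cycles in total, which leaves 2n - 2(n - 1)
  = 2.\<close>

lemma genus_one_excess:
  assumes "genus n (perm_of_partition P) = 1"
  shows "(\<Sum>B\<in>P. card B - 2) + (\<Sum>C\<in>orbit (kreweras n P) ` {1..n}. card C - 2) = 2"
proof -
  have "(\<Sum>B\<in>P. card B - 2) + 2 * card P = card {1..n}"
    by (rule sum_card_partition_excess[OF P]) (auto intro: block_card_ge_2)
  moreover have "(\<Sum>C\<in>orbit (kreweras n P) ` {1..n}. card C - 2) +
      2 * card (orbit (kreweras n P) ` {1..n}) = card {1..n}"
  proof (rule sum_card_partition_excess[OF partition_on_orbits[OF kreweras_permutes[OF P]]])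
    show "2 \<le> card C" if "C \<in> orbit (kreweras n P) ` {1..n}" for C
      using orbit_card_ge_2[OF kreweras_permutes[OF P] _ kreweras_neq that] by simp
  qed auto
  ultimately show ?thesis using genus_one_card[OF assms] by simp
qed

text \<open>
  A block of size at least 3 uses up excess 1. Two of its arcs would each need a further block
  or orbit with excess; a single orbit of size 3 cannot have two elements in each of two
  disjoint arcs.
\<close>

lemma genus_one_block_card:
  assumes g: "genus n (perm_of_partition P) = 1" and B: "B \<in> P"
  shows "card B = 2"
proof (rule ccontr)
  assume "card B \<noteq> 2"
  then have B3: "3 \<le> card B" using block_card_ge_2[OF B] by simp
  define Q where "Q = orbit (kreweras n P) ` {1..n}"
  have finP: "finite P" using finite_elements[OF _ P] by simp
  have finQ: "finite Q" by (simp add: Q_def)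
  have exc: "(\<Sum>D\<in>P. card D - 2) + (\<Sum>C\<in>Q. card C - 2) = 2"
    using genus_one_excess[OF g] by (simp add: Q_def)
  have splitB: "(\<Sum>D\<in>P. card D - 2) = (card B - 2) + (\<Sum>D\<in>P - {B}. card D - 2)"
    using finP B by (rule sum.remove)
  \<comment> \<open>\<open>B\<close> consumes at least one of the two units of excess, so at most
    one unit is left for all other blocks and orbits.\<close>
  have rest: "(\<Sum>D\<in>P - {B}. card D - 2) + (\<Sum>C\<in>Q. card C - 2) \<le> 1"
    using exc splitB B3 by simp
  have big_D: "(\<Sum>D\<in>P - {B}. card D - 2) \<ge> card D - 2" if "D \<in> P" "D \<noteq> B" for D
    using finP that by (intro member_le_sum) auto
  have big_C: "(\<Sum>C\<in>Q. card C - 2) \<ge> card C - 2" if "C \<in> Q" for C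
    using finQ that by (intro member_le_sum) auto
  have two_D: "D = D'" if "D \<in> P - {B}" "D' \<in> P - {B}" "3 \<le> card D" "3 \<le> card D'" for D D'
  proof (rule ccontr)
    assume "D \<noteq> D'"
    then have "(card D - 2) + (card D' - 2) = (\<Sum>E\<in>{D, D'}. card E - 2)" by simp
    also have "\<dots> \<le> (\<Sum>E\<in>P - {B}. card E - 2)" using finP that by (intro sum_mono2) auto
    finally show False using rest that by linarith
  qed
  have two_C: "C = C'" if "C \<in> Q" "C' \<in> Q" "3 \<le> card C" "3 \<le> card C'" for C C'
  proof (rule ccontr)
    assume "C \<noteq> C'"
    then have "(card C - 2) + (card C' - 2) = (\<Sum>E\<in>{C, C'}. card E - 2)" by simp
    also have "\<dots> \<le> (\<Sum>E\<in>Q. card E - 2)" using finQ that by (intro sum_mono2) auto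
    finally show False using rest that by linarith
  qed
  define I where "I x = insert x (cyc_gap n x (perm_of_partition P x))" for x
  \<comment> \<open>In the second alternative of \<open>arc_contains_excess\<close>, the points
    \<open>z\<close>, \<open>w\<close> and \<beta> w are distinct, so their orbit has at least 3
    points, two of them in the arc.\<close>
  have dich: "(\<exists>D \<in> P - {B}. D \<subseteq> I x \<and> 3 \<le> card D) \<or>
      (\<exists>C \<in> Q. 3 \<le> card C \<and> 2 \<le> card (C \<inter> I x))" if x: "x \<in> B" for x
  proof -
    have xn: "x \<in> {1..n}" using x block_subset[OF P B] by blast
    note next_x = perm_of_partition_next[OF P B x]
    consider D where "D \<in> P" "D \<subseteq> cyc_gap n x (perm_of_partition P x)" "3 \<le> card D"
      | z w where "z \<in> I x" "w \<in> I x" "z \<noteq> w" "kreweras n P z = w" "kreweras n P w \<noteq> z"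
      using arc_contains_excess[OF xn] unfolding I_def by blast
    then show ?thesis
    proof cases
      case (1 D)
      then have "D \<noteq> B" using next_x x by blast
      then show ?thesis using 1 unfolding I_def by blast
    next
      case (2 z w)
      have "I x \<subseteq> {1..n}" using xn by (auto simp: I_def cyc_gap_def)
      then have zn: "z \<in> {1..n}" using 2 by blast
      define C where "C = orbit (kreweras n P) z"
      have perm: "permutation (kreweras n P)"
        using kreweras_permutes[OF P] by (auto simp: permutation_permutes)
      have CQ: "C \<in> Q" using zn by (auto simp: C_def Q_def)
      have finC: "finite C"
        using permutes_orbit_subset[OF kreweras_permutes[OF P] zn] finite_subset
          by (auto simp: C_def)
      have zC: "z \<in> C" using permutation_self_in_orbit[OF perm] by (simp add: C_def)
      have wC: "w \<in> C" using 2(4) orbit.base by (metis C_def)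
      have vC: "kreweras n P w \<in> C" using wC orbit.step by (metis C_def)
      have "kreweras n P w \<noteq> w" using 2 kreweras_inject[OF P] by metis
      then have "card {z, w, kreweras n P w} = 3" using 2 by auto
      then have "3 \<le> card C" using card_mono[OF finC, of "{z, w, kreweras n P w}"] zC wC vC by simp
      moreover have "card {z, w} = 2" using 2 by simp
      then have "2 \<le> card (C \<inter> I x)"
        using card_mono[of "C \<inter> I x" "{z, w}"] finC zC wC 2 by simp
      ultimately show ?thesis using CQ by blast
    qed
  qed
  obtain x x' where xx: "x \<in> B" "x' \<in> B" "x \<noteq> x'"
  proof -
    have "2 \<le> card B" using B3 by simp
    then obtain S where "S \<subseteq> B" "card S = 2" by (meson obtain_subset_with_card_n)
    then show ?thesis using that by (auto simp: card_2_iff)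
  qed
  have disj: "I x \<inter> I x' = {}" using arcs_disjoint[OF B xx] by (simp add: I_def)
  \<comment> \<open>One unit of excess cannot serve a further block and an orbit, so the two arcs
    must find excess of the same kind.\<close>
  have no_both: False if D: "D \<in> P - {B}" "3 \<le> card D" and C: "C \<in> Q" "3 \<le> card C" for D C
    using rest big_D[of D] big_C[of C] D C by auto
  consider D D' where "D \<in> P - {B}" "D' \<in> P - {B}" "3 \<le> card D" "3 \<le> card D'" "D \<subseteq> I x" "D' \<subseteq> I x'"
    | C C' where "C \<in> Q" "C' \<in> Q" "3 \<le> card C" "3 \<le> card C'" "2 \<le> card (C \<inter> I x)"
        "2 \<le> card (C' \<inter> I x')"
    using dich[OF xx(1)] dich[OF xx(2)] no_both by blast
  then show False
  proof cases
    case (1 D D')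
    then have "D = D'" using two_D by blast
    then have "D = {}" using 1 disj by blast
    then show False using 1 by simp
  next
    case (2 C C')
    then have CC: "C = C'" using two_C by blast
    have finC: "finite C" using 2(3) by (intro card_ge_0_finite) simp
    have "card (C \<inter> I x) + card (C \<inter> I x') = card ((C \<inter> I x) \<union> (C \<inter> I x'))"
      using finC disj by (intro card_Un_disjoint[symmetric]) auto
    also have "\<dots> \<le> card C" using finC by (intro card_mono) auto
    finally have "4 \<le> card C" using 2 CC by simp
    then show False using big_C[OF 2(1)] rest by simp
  qed
qed

lemma genus_one_card_eq:
  assumes g: "genus n (perm_of_partition P) = 1"
  shows "n = 2 * card P"
    and "(\<Sum>C\<in>orbit (kreweras n P) ` {1..n}. card C - 2) = 2"
proof -
  have "(\<Sum>B\<in>P. card B - 2) + 2 * card P = card {1..n}"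
    by (rule sum_card_partition_excess[OF P]) (auto intro: block_card_ge_2)
  then show "n = 2 * card P" using genus_one_block_card[OF g] by simp
  show "(\<Sum>C\<in>orbit (kreweras n P) ` {1..n}. card C - 2) = 2"
    using genus_one_excess[OF g] genus_one_block_card[OF g] by simp
qed

end

section \<open>Turns of a matching of genus one\<close>

text \<open>The positions between \<open>i\<close> and \<open>i + 1\<close> where the parallel class of a matching changes.\<close>

definition turns :: "nat \<Rightarrow> nat set set \<Rightarrow> nat set" where
  "turns n P = {i \<in> {1..n}. kreweras n P (kreweras n P i) \<noteq> i}"

lemma turns_subset: "turns n P \<subseteq> {1..n}"
  by (auto simp: turns_def)

context
  fixes n :: nat and P :: "nat set set"
  assumes P: "partition_on {1..n} P" and fr: "fully_reduced n P"
    and g: "genus n (perm_of_partition P) = 1"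
begin

lemma perm_involution:
  assumes "i \<in> {1..n}"
  shows "perm_of_partition P (perm_of_partition P i) = i"
proof -
  obtain B where B: "B \<in> P" "i \<in> B" using block_exists[OF P assms] .
  define j where "j = perm_of_partition P i"
  have j: "j \<in> B" "j \<noteq> i"
    using perm_of_partition_next(1)[OF P B] fr assms unfolding fully_reduced_def j_def by blast+
  have card: "card B = 2" using genus_one_block_card[OF P fr g B(1)] .
  have Beq: "{i, j} = B"
  proof (rule card_subset_eq)
    show "finite B" using card by (intro card_ge_0_finite) simp
  qed (use B j card in auto)
  have "perm_of_partition P j \<in> B" using perm_of_partition_next(1)[OF P B(1) j(1)] .
  moreover have "perm_of_partition P j \<noteq> j"
    using j(1) block_subset[OF P B(1)] fr unfolding fully_reduced_def by blast
  ultimately show ?thesis unfolding Beq[symmetric] by (simp add: j_def)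
qed

lemma kreweras_eq: "i \<in> {1..n} \<Longrightarrow> kreweras n P i = perm_of_partition P (zeta n i)"
  unfolding kreweras_eq_iff[OF P] using perm_involution zeta_in by blast

lemma kreweras_turns_iff:
  assumes "i \<in> {1..n}"
  shows "kreweras n P i \<in> turns n P \<longleftrightarrow> i \<in> turns n P"
  using assms kreweras_in[OF P assms] kreweras_inject[OF P] by (simp add: turns_def)

text \<open>Off the turns, the chords at \<open>i\<close> and at its successor are parallel: as one
  end moves forward by one, the other moves back by one.\<close>

lemma zeta_perm_zeta:
  assumes "i \<in> {1..n}" "i \<notin> turns n P"
  shows "zeta n (perm_of_partition P (zeta n i)) = perm_of_partition P i"
proof -
  have "kreweras n P (kreweras n P i) = i" using assms by (simp add: turns_def)
  then show ?thesis unfolding kreweras_eq_iff[OF P] kreweras_eq[OF assms(1)] by simp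
qed

text \<open>Apply \<open>arc_contains_excess\<close> to the arc that starts at
  \<open>zeta n e\<close>. Its other end is \<beta> e because \<alpha> is an involution, and its
  first alternative fails because all blocks have size 2. This is the main constraint on how \<beta>
  permutes the turns.\<close>

lemma turn_arc:
  assumes "e \<in> {1..n}"
  shows "\<exists>z \<in> turns n P \<inter> cyc_gap n e (kreweras n P e). \<exists>w \<in> turns n P \<inter> cyc_gap n e (kreweras n P e).
    z \<noteq> w \<and> kreweras n P z = w"
proof -
  define x where "x = zeta n e"
  define y where "y = perm_of_partition P x"
  have x: "x \<in> {1..n}" using zeta_in assms by (simp add: x_def)
  have y: "y = kreweras n P e" using kreweras_eq assms by (simp add: x_def y_def)
  have "y \<in> {1..n}" using perm_in[OF P x] by (simp only: y_def)
  moreover have "y \<noteq> x" using x fr unfolding fully_reduced_def y_def by blast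
  moreover have "y \<noteq> e" unfolding y by (rule kreweras_neq[OF P fr assms])
  ultimately have gap: "insert x (cyc_gap n x y) = cyc_gap n e y"
    using assms by (auto simp: x_def zeta_apply cyc_gap_def split: if_splits)
  have no: "\<not> 3 \<le> card B" if "B \<in> P" for B using genus_one_block_card[OF P fr g that] by simp
  obtain z w where zw: "z \<in> cyc_gap n e y" "w \<in> cyc_gap n e y" "z \<noteq> w"
      "kreweras n P z = w" "kreweras n P w \<noteq> z"
    using arc_contains_excess[OF P fr x] no unfolding y_def[symmetric] gap by blast
  have z: "z \<in> turns n P" using zw by (auto simp: turns_def cyc_gap_def)
  have "w \<in> turns n P" using kreweras_turns_iff[OF subsetD[OF turns_subset z]] z zw(4) by simp
  then show ?thesis using z zw unfolding y by blast
qed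

text \<open>The turns fill exactly the orbits of \<beta> with at least 3 points. Total excess 2
  leaves one such orbit of size 4 or two of size 3.\<close>

lemma card_turns:
  "card (turns n P) = 4 \<or>
    card (turns n P) = 6 \<and> (\<forall>i \<in> turns n P. kreweras n P (kreweras n P (kreweras n P i)) = i)"
proof -
  define f where "f = kreweras n P"
  have f: "f permutes {1..n}" using kreweras_permutes[OF P] by (simp add: f_def)
  have perm: "permutation f" using f by (auto simp: permutation_permutes)
  define Q where "Q = orbit f ` {1..n}"
  have Q: "partition_on {1..n} Q" using partition_on_orbits[OF f] by (simp add: Q_def)
  have fneq: "f i \<noteq> i" if "i \<in> {1..n}" for i using kreweras_neq[OF P fr that] by (simp add: f_def)
  have finj: "f i = f j \<longleftrightarrow> i = j" for i j using kreweras_inject[OF P] by (simp add: f_def)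
  have self: "i \<in> orbit f i" for i using permutation_self_in_orbit[OF perm] .
  have orb: "orbit f i = C" if "C \<in> Q" "i \<in> C" for C i
  proof -
    have "i \<in> {1..n}" using that block_subset[OF Q] by blast
    then show ?thesis using block_unique[OF Q _ that(1) self that(2)] by (auto simp: Q_def)
  qed
  have fC: "f i \<in> C" if "C \<in> Q" "i \<in> C" for C i using orb[OF that] orbit.base by metis
  have finC: "finite C" if "C \<in> Q" for C using block_subset[OF Q that] finite_subset by blast
  have two: "2 \<le> card C" if "C \<in> Q" for C
    using orbit_card_ge_2[OF f _ fneq] that by (auto simp: Q_def)
  have turn_iff: "i \<in> turns n P \<longleftrightarrow> 3 \<le> card C" if C: "C \<in> Q" "i \<in> C" for C i
  proof
    have i: "i \<in> {1..n}" using C block_subset[OF Q] by blast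
    show "3 \<le> card C" if "i \<in> turns n P"
    proof -
      have "f (f i) \<noteq> i" using that by (simp add: turns_def f_def)
      then have "card {i, f i, f (f i)} = 3" using fneq[OF i] finj by auto
      moreover have "{i, f i, f (f i)} \<subseteq> C" using C fC by blast
      ultimately show ?thesis using card_mono[OF finC[OF C(1)]] by metis
    qed
    show "i \<in> turns n P" if "3 \<le> card C"
    proof (rule ccontr)
      assume "i \<notin> turns n P"
      then have "(f ^^ 2) i = i" using i by (simp add: turns_def f_def numeral_2_eq_2)
      then have "C = (\<lambda>m. (f ^^ m) i) ` {..<2}"
        using orbit_eq_image[where f = f and m = 2 and x = i] orb[OF C] by simp
      then have "card C \<le> 2" using card_image_le[of "{..<2::nat}" "\<lambda>m. (f ^^ m) i"] by simp
      then show False using that by simp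
    qed
  qed
  define T where "T = {C \<in> Q. 3 \<le> card C}"
  have finQ: "finite Q" by (simp add: Q_def)
  have finT: "finite T" using finQ by (simp add: T_def)
  have "(\<Sum>C\<in>Q. card C - 2) = 2" using genus_one_card_eq(2)[OF P fr g] by (simp add: Q_def f_def)
  moreover have "(\<Sum>C\<in>Q. card C - 2) = (\<Sum>C\<in>T. card C - 2)"
    using finQ two by (intro sum.mono_neutral_right) (force simp: T_def)+
  ultimately have sumT: "(\<Sum>C\<in>T. card C - 2) = 2" by simp
  have "turns n P = \<Union> T"
  proof (intro equalityI subsetI)
    fix i assume i: "i \<in> turns n P"
    then obtain C where "C \<in> Q" "i \<in> C" using turns_subset block_exists[OF Q] by blast
    then show "i \<in> \<Union> T" using turn_iff i by (auto simp: T_def)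
  next
    fix i assume "i \<in> \<Union> T"
    then show "i \<in> turns n P" using turn_iff by (auto simp: T_def)
  qed
  moreover have "card (\<Union> T) = (\<Sum>C\<in>T. card C)"
    using partition_onD2[OF Q] finC
    by (intro card_Union_disjoint) (auto simp: T_def disjoint_def pairwise_def disjnt_def)
  ultimately have cardturns: "card (turns n P) = (\<Sum>C\<in>T. card C)" by simp
  have "1 \<le> card C - 2" if "C \<in> T" for C using that by (auto simp: T_def)
  then have "(\<Sum>C\<in>T. 1) \<le> (\<Sum>C\<in>T. card C - 2)" by (rule sum_mono)
  then have "card T \<le> (\<Sum>C\<in>T. card C - 2)" by simp
  then have "card T \<le> 2" using sumT by simp
  moreover have "card T \<noteq> 0" using sumT finT by auto
  ultimately consider "card T = 1" | "card T = 2" by linarith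
  then show ?thesis
  proof cases
    case 1
    then obtain C where "T = {C}" by (auto simp: card_1_singleton_iff)
    then show ?thesis using sumT cardturns by auto
  next
    case 2
    then obtain C D where T: "T = {C, D}" "C \<noteq> D" by (auto simp: card_2_iff)
    then have "card C \<ge> 3" "card D \<ge> 3" by (auto simp: T_def)
    moreover have "(card C - 2) + (card D - 2) = 2" using sumT T by simp
    ultimately have c3: "card C = 3" "card D = 3" by auto
    have "f (f (f i)) = i" if i: "i \<in> turns n P" for i
    proof -
      obtain C' where C': "C' \<in> T" "i \<in> C'" using \<open>turns n P = \<Union> T\<close> i by blast
      have "card C' = 3" using C' T c3 by auto
      have CQ: "C' \<in> Q" using C' by (simp add: T_def)
      have i: "i \<in> {1..n}" "f (f i) \<noteq> i" using i by (auto simp: turns_def f_def)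
      then have c: "card {i, f i, f (f i)} = 3" using fneq[OF i(1)] finj by auto
      have "{i, f i, f (f i)} = C'"
        using card_subset_eq[OF finC[OF CQ]] c \<open>card C' = 3\<close> fC[OF CQ] C' by simp
      moreover have "f (f (f i)) \<in> C'" using C' fC[OF CQ] by blast
      moreover have "f (f (f i)) \<noteq> f i" "f (f (f i)) \<noteq> f (f i)" using finj i fneq[OF i(1)] by auto
      ultimately show ?thesis by blast
    qed
    moreover have "card (turns n P) = 6" using cardturns T c3 by simp
    ultimately show ?thesis by (simp add: f_def)
  qed
qed

text \<open>Otherwise \<open>e'\<close>, \<open>e\<close>, \<open>z\<close> is a 3-cycle of \<beta>,
  where z = \<beta> e. Following the parallel chords from \<open>e\<close> to \<open>e'\<close>,
  whose distance is \<open>t\<close>, moves the partner back from \<open>z\<close> by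
  \<open>t - 1\<close> steps, while the cycle requires \<alpha> e' = \<open>zeta n z\<close>. Then
  \<open>t\<close> steps of \<open>zeta n\<close> would fix \<open>z\<close>, although 0 < t <
  n.\<close>

lemma kreweras_ne_prev:
  assumes e: "e \<in> turns n P" "e' \<in> turns n P" "e \<noteq> e'" and gap: "turns n P \<inter> cyc_gap n e e' = {}"
    and cube: "\<forall>i \<in> turns n P. kreweras n P (kreweras n P (kreweras n P i)) = i"
  shows "kreweras n P e' \<noteq> e"
proof
  assume be: "kreweras n P e' = e"
  have en: "e \<in> {1..n}" "e' \<in> {1..n}" using e turns_subset[of n P] by auto
  obtain t where t: "0 < t" "t < n" "(zeta n ^^ t) e = e'"
    "\<And>s. 0 < s \<Longrightarrow> s < t \<Longrightarrow> (zeta n ^^ s) e \<in> cyc_gap n e e'"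
    using zeta_funpow_reach[OF en e(3)] by blast
  define z where "z = kreweras n P e"
  have z: "z \<in> {1..n}" using kreweras_in[OF P en(1)] by (simp add: z_def)
  have "kreweras n P z = e'" using cube e(2) be by (auto simp: z_def)
  then have me': "perm_of_partition P e' = zeta n z" unfolding kreweras_eq_iff[OF P] .
  have "(zeta n ^^ s) (perm_of_partition P ((zeta n ^^ Suc s) e)) = z" if "Suc s \<le> t" for s
    using that
  proof (induction s)
    case 0
    then show ?case using kreweras_eq[OF en(1)] by (simp add: z_def)
  next
    case (Suc s)
    define i where "i = (zeta n ^^ Suc s) e"
    have "i \<in> {1..n}" using zeta_funpow_in[OF en(1)] unfolding i_def .
    moreover have "i \<notin> turns n P" using t(4)[of "Suc s"] gap Suc.prems unfolding i_def by auto
    ultimately have "zeta n (perm_of_partition P (zeta n i)) = perm_of_partition P i"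
      by (rule zeta_perm_zeta)
    then show ?case using Suc by (simp add: i_def funpow_swap1)
  qed
  from this[of "t - 1"] have "(zeta n ^^ (t - 1)) (zeta n z) = z" using t me' by simp
  then have "(zeta n ^^ t) z = z" using t(1) by (cases t) (auto simp: funpow_swap1)
  then show False using zeta_funpow_neq[OF z t(1,2)] by blast
qed

end

section \<open>Classification of the contracted partitions\<close>

text \<open>
  From 1 to \<open>n\<close>, the endpoints of the chord classes read \<open>A\<^sup>u B\<^sup>q C\<^sup>r A\<^sup>u D\<^sup>s B\<^sup>q C\<^sup>r D\<^sup>s\<close>. On
  each class \<open>i + matching i\<close> is constant. The classes \<open>A\<close> and \<open>D\<close> are parallel across the cut
  between \<open>n\<close> and \<open>1\<close>; requiring \<open>q \<ge> 1\<close> makes the parameters unique.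
\<close>

definition matching :: "nat \<Rightarrow> nat \<Rightarrow> nat \<Rightarrow> nat \<Rightarrow> nat \<Rightarrow> nat" where
  "matching u q r s i =
    (if i \<le> u then 2 * u + q + r + 1 - i
     else if i \<le> u + q then 3 * u + 2 * q + r + s + 1 - i
     else if i \<le> u + q + r then 3 * u + 3 * q + 2 * r + s + 1 - i
     else if i \<le> 2 * u + q + r then 2 * u + q + r + 1 - i
     else if i \<le> 2 * u + q + r + s then 4 * u + 3 * q + 3 * r + 2 * s + 1 - i
     else if i \<le> 2 * u + 2 * q + r + s then 3 * u + 2 * q + r + s + 1 - i
     else if i \<le> 2 * u + 2 * q + 2 * r + s then 3 * u + 3 * q + 2 * r + s + 1 - i
     else 4 * u + 3 * q + 3 * r + 2 * s + 1 - i)"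

context
  fixes n :: nat and P :: "nat set set"
  assumes P: "partition_on {1..n} P" and fr: "fully_reduced n P"
    and g: "genus n (perm_of_partition P) = 1"
begin

lemma kreweras_ne_next:
  assumes "e \<in> turns n P" "turns n P \<inter> cyc_gap n e e' = {}"
  shows "kreweras n P e \<noteq> e'"
proof
  assume "kreweras n P e = e'"
  then show False using turn_arc[OF P fr g subsetD[OF turns_subset assms(1)]] assms(2) by simp
qed

text \<open>If there are only two parallel classes, then \<open>e\<^sub>2 = e\<^sub>3\<close> and \<open>e\<^sub>5 = e\<^sub>6\<close>.\<close>

lemma sorted_turns:
  obtains e1 e2 e3 e4 e5 e6 where "turns n P = {e1, e2, e3, e4, e5, e6}"
    "e1 < e2" "e2 \<le> e3" "e3 < e4" "e4 < e5" "e5 \<le> e6" "e2 = e3 \<longleftrightarrow> e5 = e6"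
    "kreweras n P e1 = e5" "e2 < e3 \<Longrightarrow> kreweras n P e2 = e6" "kreweras n P e6 = e4"
proof -
  define xs where "xs = sorted_list_of_set (turns n P)"
  have fin: "finite (turns n P)" by (rule finite_subset[OF turns_subset]) simp
  have xs: "set xs = turns n P" "sorted_wrt (<) xs" "length xs = card (turns n P)"
    using fin by (auto simp: xs_def)
  have turn: "kreweras n P e \<in> turns n P" if "e \<in> turns n P" for e
    using kreweras_turns_iff[OF P fr g subsetD[OF turns_subset that]] that by (simp only:)
  have arc: "\<exists>z \<in> turns n P \<inter> cyc_gap n e (kreweras n P e).
      \<exists>w \<in> turns n P \<inter> cyc_gap n e (kreweras n P e). z \<noteq> w \<and> kreweras n P z = w" if "e \<in> turns n P" for e
    using turn_arc[OF P fr g subsetD[OF turns_subset that]] .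
  have neq: "kreweras n P e \<noteq> e" if "e \<in> turns n P" for e
    using kreweras_neq[OF P fr subsetD[OF turns_subset that]] .
  from card_turns[OF P fr g] show ?thesis
  proof (elim disjE conjE)
    assume 1: "card (turns n P) = 4"
    then obtain e1 e2 e3 e4 where "xs = [e1, e2, e3, e4]"
      using xs(3) by (auto simp: numeral_eq_Suc length_Suc_conv)
    then have t: "turns n P = {e1, e2, e3, e4}" and o: "e1 < e2" "e2 < e3" "e3 < e4"
      using xs by auto
    \<comment> \<open>With four turns, the two turns that \<open>turn_arc\<close> places strictly
      between a turn and its image force the image to be the cyclically preceding turn.\<close>
    have b1: "kreweras n P e1 = e4"
      using turn[of e1] arc[of e1] neq[of e1] o unfolding t by (auto simp: cyc_gap_def)
    have b4: "kreweras n P e4 = e3"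
      using turn[of e4] arc[of e4] neq[of e4] o unfolding t by (auto simp: cyc_gap_def)
    \<comment> \<open>The second and the fifth of the six names are doubled, which corresponds to an
      empty class C.\<close>
    show ?thesis by (rule that[of e1 e2 e2 e3 e4 e4]) (use t o b1 b4 in simp_all)
  next
    assume 2: "card (turns n P) = 6"
      "\<forall>i \<in> turns n P. kreweras n P (kreweras n P (kreweras n P i)) = i"
    then obtain e1 e2 e3 e4 e5 e6 where "xs = [e1, e2, e3, e4, e5, e6]"
      using xs(3) by (auto simp: numeral_eq_Suc length_Suc_conv)
    then have t: "turns n P = {e1, e2, e3, e4, e5, e6}"
      and o: "e1 < e2" "e2 < e3" "e3 < e4" "e4 < e5" "e5 < e6"
      using xs by auto
    have gaps: "turns n P \<inter> cyc_gap n e1 e2 = {}" "turns n P \<inter> cyc_gap n e2 e3 = {}"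
      "turns n P \<inter> cyc_gap n e3 e4 = {}" "turns n P \<inter> cyc_gap n e4 e5 = {}"
      "turns n P \<inter> cyc_gap n e5 e6 = {}" "turns n P \<inter> cyc_gap n e6 e1 = {}"
      using o unfolding t by (auto simp: cyc_gap_def)
    have mem: "e1 \<in> turns n P" "e2 \<in> turns n P" "e3 \<in> turns n P" "e4 \<in> turns n P"
      "e5 \<in> turns n P" "e6 \<in> turns n P"
      by (simp_all add: t)
    have prev: "kreweras n P e2 \<noteq> e1" "kreweras n P e3 \<noteq> e2" "kreweras n P e4 \<noteq> e3"
      "kreweras n P e5 \<noteq> e4" "kreweras n P e6 \<noteq> e5" "kreweras n P e1 \<noteq> e6"
      using kreweras_ne_prev[OF P fr g _ _ _ _ 2(2)] gaps mem o by simp_all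
    have nxt: "kreweras n P e1 \<noteq> e2" "kreweras n P e2 \<noteq> e3" "kreweras n P e3 \<noteq> e4"
      "kreweras n P e4 \<noteq> e5" "kreweras n P e5 \<noteq> e6" "kreweras n P e6 \<noteq> e1"
      using kreweras_ne_next gaps mem by blast+
    \<comment> \<open>By \<open>turn_arc\<close>, the image of a turn is not two places ahead. It is
      not three places ahead either, since the two turns in between are neighbours, which
      \<open>prev\<close> and \<open>nxt\<close> forbid to be mapped to one another. As
      \<open>prev\<close> and \<open>nxt\<close> also exclude five places and one place, \<beta>
      advances these turns by four places.\<close>
    have one: "kreweras n P e \<noteq> e'"
      if "e \<in> turns n P" "turns n P \<inter> cyc_gap n e e' = {a}" for e e' a
      using arc[OF that(1)] that(2) by (metis singletonD)
    have two: "kreweras n P e \<noteq> e'"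
      if "e \<in> turns n P" "turns n P \<inter> cyc_gap n e e' = {a, b}"
        "kreweras n P a \<noteq> b" "kreweras n P b \<noteq> a" for e e' a b
    proof
      assume eq: "kreweras n P e = e'"
      show False using arc[OF that(1)] that(3,4) unfolding eq that(2) by auto
    qed
    have gaps1: "turns n P \<inter> cyc_gap n e1 e3 = {e2}" "turns n P \<inter> cyc_gap n e2 e4 = {e3}"
      "turns n P \<inter> cyc_gap n e6 e2 = {e1}"
      and gaps2: "turns n P \<inter> cyc_gap n e1 e4 = {e2, e3}" "turns n P \<inter> cyc_gap n e2 e5 = {e3, e4}"
      "turns n P \<inter> cyc_gap n e6 e3 = {e1, e2}"
      using o mem[THEN subsetD[OF turns_subset]] unfolding t by (auto simp: cyc_gap_def)
    have b1: "kreweras n P e1 = e5"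
      using turn[OF mem(1)] neq[OF mem(1)] one[OF mem(1) gaps1(1)] two[OF mem(1) gaps2(1)] prev nxt
      unfolding t by blast
    have b2: "kreweras n P e2 = e6"
      using turn[OF mem(2)] neq[OF mem(2)] one[OF mem(2) gaps1(2)] two[OF mem(2) gaps2(2)] prev nxt
      unfolding t by blast
    have b6: "kreweras n P e6 = e4"
      using turn[OF mem(6)] neq[OF mem(6)] one[OF mem(6) gaps1(3)] two[OF mem(6) gaps2(3)] prev nxt
      unfolding t by blast
    show ?thesis by (rule that[of e1 e2 e3 e4 e5 e6]) ((rule t b1 b2 b6 | use o in linarith)+)
  qed
qed

text \<open>Along a stretch without turns the partner descends by one at each step. It is \<beta> of
  a point that is not a turn, so it never hits the turn \<open>c\<close>; staying above
  \<open>c\<close>, it cannot wrap around at 1. At a turn \<open>hi\<close>, the point before its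
  partner is mapped to \<open>hi\<close> by \<beta> and is therefore a turn as well.\<close>

lemma parallel_run:
  assumes lo: "1 \<le> lo" "lo \<le> hi" "hi \<le> n" and no: "\<And>i. lo \<le> i \<Longrightarrow> i < hi \<Longrightarrow> i \<notin> turns n P"
    and c: "c \<in> turns n P" "c < perm_of_partition P lo"
  shows "\<And>i. lo \<le> i \<Longrightarrow> i \<le> hi \<Longrightarrow>
      perm_of_partition P i + i = perm_of_partition P lo + lo \<and> c < perm_of_partition P i"
    and "hi \<in> turns n P \<Longrightarrow> perm_of_partition P hi - 1 \<in> turns n P"
proof -
  have c1: "1 \<le> c" using c(1) turns_subset[of n P] by auto
  show A: "perm_of_partition P i + i = perm_of_partition P lo + lo \<and> c < perm_of_partition P i"
    if "lo \<le> i" "i \<le> hi" for i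
    using that
  proof (induction i rule: dec_induct)
    case base
    then show ?case using c by simp
  next
    case (step i)
    define v where "v = perm_of_partition P (zeta n i)"
    have i: "i \<in> {1..n}" "i \<notin> turns n P" using step lo no by auto
    have zi: "zeta n i = Suc i" using i step.prems lo by (auto simp: zeta_apply)
    have zv: "zeta n v = perm_of_partition P i" using zeta_perm_zeta[OF P fr g i]
        by (simp add: v_def)
    have v: "v \<in> {1..n}" unfolding v_def by (intro perm_in[OF P] zeta_in i)
    have "kreweras n P i = v" using kreweras_eq[OF P fr g i(1)] by (simp add: v_def)
    then have "v \<notin> turns n P" using kreweras_turns_iff[OF P fr g i(1)] i(2) by simp
    then have "v \<noteq> c" using c by blast
    moreover have "c < perm_of_partition P i"
        "perm_of_partition P i + i = perm_of_partition P lo + lo"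
      using step by auto
    ultimately show ?case
      using zv v c1 unfolding zeta_apply[OF v] by (auto simp: v_def zi split: if_splits)
  qed
  show "perm_of_partition P hi - 1 \<in> turns n P" if hi: "hi \<in> turns n P"
  proof -
    have hn: "hi \<in> {1..n}" using lo by simp
    define z where "z = perm_of_partition P hi - 1"
    have chi: "c < perm_of_partition P hi" using A[of hi] lo by simp
    then have z: "z \<in> {1..n}" using perm_in[OF P hn] c1 by (auto simp: z_def)
    have "zeta n z = perm_of_partition P hi"
      using chi perm_in[OF P hn] c1 by (subst zeta_apply[OF z]) (auto simp: z_def)
    note z = z this
    have "kreweras n P z = hi" using kreweras_eq_iff[OF P] z(2) by metis
    then show ?thesis using kreweras_turns_iff[OF P fr g z(1)] hi by (simp add: z_def)
  qed
qed

lemma perm_eq_matching: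
  obtains u q r s where "1 \<le> u" "1 \<le> q" "u + q + r + s = card P"
    "\<And>i. i \<in> {1..n} \<Longrightarrow> perm_of_partition P i = matching u q r s i"
proof -
  obtain e1 e2 e3 e4 e5 e6 where t: "turns n P = {e1, e2, e3, e4, e5, e6}"
    and o: "e1 < e2" "e2 \<le> e3" "e3 < e4" "e4 < e5" "e5 \<le> e6" "e2 = e3 \<longleftrightarrow> e5 = e6"
    and b: "kreweras n P e1 = e5" "e2 < e3 \<Longrightarrow> kreweras n P e2 = e6" "kreweras n P e6 = e4"
    using sorted_turns by metis
  define m where "m = perm_of_partition P"
  have en: "1 \<le> e1" "e6 \<le> n" using turns_subset[of n P] unfolding t by auto
  have minv: "m (m i) = i" if "i \<in> {1..n}" for i using perm_involution[OF P fr g that]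
      by (simp add: m_def)
  have m1: "m (Suc e1) = e5" using b(1) kreweras_eq[OF P fr g, of e1] en o
      by (simp add: zeta_apply m_def)
  have m2: "m (Suc e2) = e6" if "e2 < e3"
    using b(2)[OF that] kreweras_eq[OF P fr g, of e2] en o by (simp add: zeta_apply m_def)
  have m6: "m (zeta n e6) = e4" using b(3) kreweras_eq[OF P fr g, of e6] en o by (simp add: m_def)
  have run1: "m i + i = e5 + Suc e1 \<and> e4 < m i" if "Suc e1 \<le> i" "i \<le> e2" for i
    using parallel_run(1)[of "Suc e1" e2 e4 i] m1 that o en by (auto simp: t m_def)
  \<comment> \<open>The point before the partner of \<open>e2\<close> is a turn that is at least
    \<open>e4\<close> and below \<open>e5\<close>, hence it is \<open>e4\<close>. This equates the
    lengths of the two occurrences of class B; the same argument gives \<open>q2\<close> and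
    \<open>q4\<close>.\<close>
  have "m e2 - 1 \<in> turns n P"
    using parallel_run(2)[of "Suc e1" e2 e4] m1 o en by (auto simp: t m_def)
  then have q1: "e5 + e1 = e4 + e2" using run1[of e2] o unfolding t by auto
  have run2: "m i + i = e6 + Suc e2 \<and> e5 < m i" if "Suc e2 \<le> i" "i \<le> e3" for i
    using parallel_run(1)[of "Suc e2" e3 e5 i] m2 that o en by (auto simp: t m_def)
  have q2: "e6 + e2 = e5 + e3"
  proof (cases "e2 = e3")
    case True
    then show ?thesis using o by simp
  next
    case False
    then have "m e3 - 1 \<in> turns n P"
      using parallel_run(2)[of "Suc e2" e3 e5] m2 o en by (auto simp: t m_def)
    then show ?thesis using run2[of e3] o False unfolding t by auto
  qed
  have run3: "m i + i = e4 + Suc e6 \<and> e3 < m i" if "Suc e6 \<le> i" "i \<le> n" for i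
    using parallel_run(1)[of "Suc e6" n e3 i] m6 that o en by (auto simp: t m_def zeta_apply)
  \<comment> \<open>If \<open>e6 = n\<close>, the partner of 1 is \<open>e4\<close>. Otherwise
    \<open>n\<close> is not a turn, and the chords at \<open>n\<close> and 1 are parallel, which
    carries the value of \<open>run3\<close> across the cut.\<close>
  have first: "m 1 + n = e4 + e6 \<and> e3 < m 1"
  proof (cases "e6 = n")
    case True
    then show ?thesis using m6 o en by (simp add: zeta_apply)
  next
    case False
    then have n: "n \<in> {1..n}" "n \<notin> turns n P" using o en unfolding t by auto
    have "zeta n n = 1" using n by (simp add: zeta_apply)
    then have eq: "zeta n (m 1) = m n" "kreweras n P n = m 1"
      using zeta_perm_zeta[OF P fr g n] kreweras_eq[OF P fr g n(1)] by (simp_all add: m_def)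
    then have "m 1 \<notin> turns n P" "m 1 \<in> {1..n}"
      using kreweras_turns_iff[OF P fr g n(1)] n kreweras_in[OF P n(1)] by auto
    then show ?thesis
      using run3[of n] False en o eq(1) unfolding t by (auto simp: zeta_apply split: if_splits)
  qed
  have run4: "m i + i = m 1 + 1 \<and> e3 < m i" if "1 \<le> i" "i \<le> e1" for i
    using parallel_run(1)[of 1 e1 e3 i] first that o en by (auto simp: t m_def)
  have "m e1 - 1 \<in> turns n P"
    using parallel_run(2)[of 1 e1 e3] first o en by (auto simp: t m_def)
  then have q4: "m 1 = e3 + e1" using run4[of e1] o en first unfolding t by auto
  \<comment> \<open>These are the sizes of the classes A, B, C and D, where D is read off after the
    last turn. The relations collected so far express all turns and \<open>n\<close> through
    them.\<close>
  define u q r s where "u = e1" and "q = e2 - e1" and "r = e3 - e2" and "s = n - e6"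
  have e: "e1 = u" "e2 = u + q" "e3 = u + q + r" "e4 = 2 * u + q + r + s"
      "e5 = 2 * u + 2 * q + r + s"
    "e6 = 2 * u + 2 * q + 2 * r + s" "n = 2 * u + 2 * q + 2 * r + 2 * s"
    using o en q1 q2 q4 first by (auto simp: u_def q_def r_def s_def)
  have uq: "1 \<le> u" "1 \<le> q" using en o by (auto simp: u_def q_def)
  have half: "m i = matching u q r s i"
    if ii: "i \<in> {1..n}" "i \<le> e3 \<or> e6 < i" for i
  proof -
    have "1 \<le> i \<and> i \<le> e1 \<or> Suc e1 \<le> i \<and> i \<le> e2 \<or> Suc e2 \<le> i \<and> i \<le> e3 \<or> Suc e6 \<le> i \<and> i \<le> n"
      using ii by auto
    then consider "1 \<le> i" "i \<le> e1" | "Suc e1 \<le> i" "i \<le> e2" | "Suc e2 \<le> i" "i \<le> e3" | "Suc e6 \<le> i"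
        "i \<le> n"
      by blast
    then show ?thesis
    proof cases
      case 1
      then show ?thesis using run4[of i] q4 unfolding matching_def e by auto
    next
      case 2
      then show ?thesis using run1[of i] unfolding matching_def e by auto
    next
      case 3
      then show ?thesis using run2[of i] unfolding matching_def e by auto
    next
      case 4
      then show ?thesis using run3[of i] unfolding matching_def e by auto
    qed
  qed
  \<comment> \<open>\<open>half\<close> covers the first occurrences of A, B, C and the second one
    of D. Every remaining point is the partner of a covered one, and both maps are
    involutions.\<close>
  have all: "m i = matching u q r s i" if i: "i \<in> {1..n}" for i
  proof (cases "i \<le> e3 \<or> e6 < i")
    case True
    then show ?thesis using half i by blast
  next
    case False
    define j where "j = matching u q r s i"
    have j: "j \<in> {1..n}" "j \<le> e3 \<or> e6 < j" "matching u q r s j = i"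
      using False i unfolding j_def matching_def e by auto
    then have "m j = i" using half by blast
    then show ?thesis using minv[OF j(1)] by (simp add: j_def)
  qed
  have "u + q + r + s = card P" using genus_one_card_eq(1)[OF P fr g] e(7) by simp
  then show ?thesis using that uq all by (simp add: m_def)
qed

end

section \<open>Counting the contracted partitions\<close>

lemma perm_of_partition_inject:
  assumes P: "partition_on {1..n} P" and Q: "partition_on {1..n} Q"
    and eq: "\<And>i. i \<in> {1..n} \<Longrightarrow> perm_of_partition P i = perm_of_partition Q i"
  shows "P = Q"
proof -
  have "perm_of_partition P = perm_of_partition Q"
  proof
    fix i show "perm_of_partition P i = perm_of_partition Q i"
      using eq permutes_not_in[OF perm_of_partition_permutes[OF P]]
        permutes_not_in[OF perm_of_partition_permutes[OF Q]] by (cases "i \<in> {1..n}") simp_all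
  qed
  then show ?thesis using partition_eq_orbits[OF P] partition_eq_orbits[OF Q] by simp
qed

section \<open>The explicit matchings are contracted partitions of genus one\<close>

definition matching_partition :: "nat \<Rightarrow> nat \<Rightarrow> nat \<Rightarrow> nat \<Rightarrow> nat set set" where
  "matching_partition u q r s = (\<lambda>i. {i, matching u q r s i}) ` {1..2 * (u + q + r + s)}"

context
  fixes u q r s :: nat
  assumes u: "1 \<le> u" and q: "1 \<le> q"
begin

lemma matching_in:
  "i \<in> {1..2 * (u + q + r + s)} \<Longrightarrow> matching u q r s i \<in> {1..2 * (u + q + r + s)}"
  using u q by (auto simp: matching_def)

lemma matching_neq: "i \<in> {1..2 * (u + q + r + s)} \<Longrightarrow> matching u q r s i \<noteq> i"
  using u q by (auto simp: matching_def split: if_splits)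

lemma matching_neq_zeta:
  "i \<in> {1..2 * (u + q + r + s)} \<Longrightarrow> matching u q r s i \<noteq> zeta (2 * (u + q + r + s)) i"
  using u q by (auto simp: zeta_apply matching_def split: if_splits)

lemma matching_involution:
  assumes "i \<in> {1..2 * (u + q + r + s)}"
  shows "matching u q r s (matching u q r s i) = i"
proof -
  consider "i \<le> u" | "u < i" "i \<le> u + q" | "u + q < i" "i \<le> u + q + r"
    | "u + q + r < i" "i \<le> 2 * u + q + r" | "2 * u + q + r < i" "i \<le> 2 * u + q + r + s"
    | "2 * u + q + r + s < i" "i \<le> 2 * u + 2 * q + r + s"
    | "2 * u + 2 * q + r + s < i" "i \<le> 2 * u + 2 * q + 2 * r + s" | "2 * u + 2 * q + 2 * r + s < i"
    by linarith
  then show ?thesis using assms by cases (auto simp: matching_def)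
qed

lemma matching_block:
  assumes "B \<in> matching_partition u q r s" "i \<in> B"
  shows "B = {i, matching u q r s i}" and "i \<in> {1..2 * (u + q + r + s)}"
proof -
  obtain j where j: "j \<in> {1..2 * (u + q + r + s)}" "B = {j, matching u q r s j}"
    using assms by (auto simp: matching_partition_def)
  then show "B = {i, matching u q r s i}" using assms(2) matching_involution[OF j(1)] by auto
  show "i \<in> {1..2 * (u + q + r + s)}" using j assms(2) matching_in[OF j(1)] by blast
qed

lemma partition_on_matching: "partition_on {1..2 * (u + q + r + s)} (matching_partition u q r s)"
proof (rule partition_onI)
  have "i \<in> \<Union> (matching_partition u q r s)" if "i \<in> {1..2 * (u + q + r + s)}" for i
    using that unfolding matching_partition_def by blast
  then show "\<Union> (matching_partition u q r s) = {1..2 * (u + q + r + s)}"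
    using matching_block(2) by blast
  show "{} \<notin> matching_partition u q r s" by (auto simp: matching_partition_def)
  show "disjnt B C" if "B \<in> matching_partition u q r s" "C \<in> matching_partition u q r s" "B \<noteq> C"
      for B C
    using that matching_block(1) unfolding disjnt_iff by metis
qed

lemma perm_of_matching_partition:
  assumes i: "i \<in> {1..2 * (u + q + r + s)}"
  shows "perm_of_partition (matching_partition u q r s) i = matching u q r s i"
proof -
  have B: "{i, matching u q r s i} \<in> matching_partition u q r s"
    using i by (auto simp: matching_partition_def)
  show ?thesis
  proof (rule perm_of_partition_eqI[OF partition_on_matching B])
    show "{i, matching u q r s i} \<inter> cyc_gap (2 * (u + q + r + s)) i (matching u q r s i) = {}"
      using matching_neq[OF i] by (auto simp: cyc_gap_def)
  qed auto
qed

lemma fully_reduced_matching: "fully_reduced (2 * (u + q + r + s)) (matching_partition u q r s)"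
  unfolding fully_reduced_def using perm_of_matching_partition matching_neq matching_neq_zeta
    by simp

lemma card_matching_partition: "card (matching_partition u q r s) = u + q + r + s"
proof -
  have "card B = 2" if "B \<in> matching_partition u q r s" for B
  proof -
    obtain j where j: "j \<in> {1..2 * (u + q + r + s)}" "B = {j, matching u q r s j}"
      using \<open>B \<in> _\<close> by (auto simp: matching_partition_def)
    then show ?thesis using matching_neq[OF j(1)] by simp
  qed
  then have "(\<Sum>B\<in>matching_partition u q r s. card B - 2) + 2 * card (matching_partition u q r s) =
      card {1..2 * (u + q + r + s)}"
    by (intro sum_card_partition_excess[OF partition_on_matching]) auto
  then show ?thesis using \<open>\<And>B. B \<in> _ \<Longrightarrow> card B = 2\<close> by simp
qed

lemma kreweras_matching:
  assumes i: "i \<in> {1..2 * (u + q + r + s)}"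
  shows "kreweras (2 * (u + q + r + s)) (matching_partition u q r s) i =
    matching u q r s (zeta (2 * (u + q + r + s)) i)"
  unfolding kreweras_eq_iff[OF partition_on_matching]
  using perm_of_matching_partition[OF matching_in[OF zeta_in[OF i]]]
    matching_involution[OF zeta_in[OF i]] by simp

text \<open>The excluded points are the ends of the letters in A^u B^q C^r A^u D^s B^q C^r D^s,
  except for the boundary from A to D and the point \<open>n\<close>, across which A and D are
  parallel. For \<open>s = 0\<close> these two points coincide with excluded ones, hence
  \<open>0 < s\<close> in cases 5 and 10.\<close>

lemma matching_parallel:
  assumes i: "i \<in> {1..2 * (u + q + r + s)}"
    and no: "i \<notin> {u, u + q, u + q + r, 2 * u + q + r + s, 2 * u + 2 * q + r + s, 2 * u + 2 * q + 2 * r + s}"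
  shows "zeta (2 * (u + q + r + s)) (matching u q r s (zeta (2 * (u + q + r + s)) i)) =
    matching u q r s i"
proof -
  define j where "j = zeta (2 * (u + q + r + s)) i"
  have j: "j = (if i = 2 * (u + q + r + s) then 1 else Suc i)"
    using zeta_apply[OF i] by (simp add: j_def)
  have jin: "j \<in> {1..2 * (u + q + r + s)}" using zeta_in[OF i] by (simp only: j_def)
  have "(if matching u q r s j = 2 * (u + q + r + s) then 1 else Suc (matching u q r s j)) =
      matching u q r s i"
  proof -
    consider (1) "i \<le> u" | (2) "u < i" "i \<le> u + q" | (3) "u + q < i" "i \<le> u + q + r"
      | (4) "u + q + r < i" "i < 2 * u + q + r" | (5) "i = 2 * u + q + r"
      | (6) "2 * u + q + r < i" "i \<le> 2 * u + q + r + s"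
      | (7) "2 * u + q + r + s < i" "i \<le> 2 * u + 2 * q + r + s"
      | (8) "2 * u + 2 * q + r + s < i" "i \<le> 2 * u + 2 * q + 2 * r + s"
      | (9) "2 * u + 2 * q + 2 * r + s < i" "i < 2 * (u + q + r + s)" | (10)
          "i = 2 * (u + q + r + s)"
      using i unfolding atLeastAtMost_iff by linarith
    then show ?thesis
    proof cases
      case 1
      then have "i < u" using no by simp
      then show ?thesis using i unfolding j by (auto simp: matching_def)
    next
      case 2
      then have "i < u + q" using no by simp
      then show ?thesis using i 2 unfolding j by (auto simp: matching_def)
    next
      case 3
      then have "i < u + q + r" using no by simp
      then show ?thesis using i 3 unfolding j by (auto simp: matching_def)
    next
      case 4
      then show ?thesis using i unfolding j by (auto simp: matching_def)
    next
      case 5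
      then have "0 < s" using no by auto
      then show ?thesis using i 5 u q unfolding j by (auto simp: matching_def)
    next
      case 6
      then have "i < 2 * u + q + r + s" using no by simp
      then show ?thesis using i 6 unfolding j by (auto simp: matching_def)
    next
      case 7
      then have "i < 2 * u + 2 * q + r + s" using no by simp
      then show ?thesis using i 7 unfolding j by (auto simp: matching_def)
    next
      case 8
      then have "i < 2 * u + 2 * q + 2 * r + s" using no by simp
      then show ?thesis using i 8 unfolding j by (auto simp: matching_def)
    next
      case 9
      then show ?thesis using i unfolding j by (auto simp: matching_def)
    next
      case 10
      then have "0 < s" using no by auto
      then show ?thesis using i 10 u q unfolding j by (auto simp: matching_def)
    qed
  qed
  then show ?thesis using zeta_apply[OF matching_in[OF jin]] by (simp add: j_def)
qed

text \<open>By \<open>matching_parallel\<close>, \<beta> has only 2-cycles away from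
  \<open>e1\<close>, ..., \<open>e6\<close>. Those points form two 3-cycles, or one 4-cycle if
  \<open>r = 0\<close> makes \<open>e2 = e3\<close> and \<open>e5 = e6\<close>. In both cases the
  excess is 2, so \<beta> has one cycle less than there are chords.\<close>

lemma genus_matching:
  "genus (2 * (u + q + r + s)) (perm_of_partition (matching_partition u q r s)) = 1"
proof -
  define N where "N = 2 * (u + q + r + s)"
  define f where "f = kreweras N (matching_partition u q r s)"
  note P = partition_on_matching[folded N_def]
  note fr = fully_reduced_matching[folded N_def]
  have f: "f permutes {1..N}" using kreweras_permutes[OF P] by (simp add: f_def)
  have perm: "permutation f" using f by (auto simp: permutation_permutes)
  have fm: "f i = matching u q r s (zeta N i)" if "i \<in> {1..N}" for i
    using kreweras_matching[folded N_def, OF that] by (simp add: f_def)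
  define e1 e2 e3 e4 e5 e6 where "e1 = u" and "e2 = u + q" and "e3 = u + q + r"
    and "e4 = 2 * u + q + r + s" and "e5 = 2 * u + 2 * q + r + s" and
        "e6 = 2 * u + 2 * q + 2 * r + s"
  note e = e1_def e2_def e3_def e4_def e5_def e6_def
  define Q where "Q = orbit f ` {1..N}"
  have Q: "partition_on {1..N} Q" using partition_on_orbits[OF f] by (simp add: Q_def)
  have two: "2 \<le> card C" if "C \<in> Q" for C
    using orbit_card_ge_2[OF f] kreweras_neq[OF P fr] that by (simp add: Q_def f_def)
  have pair: "card (orbit f i) = 2" if i: "i \<in> {1..N}" "i \<notin> {e1, e2, e3, e4, e5, e6}" for i
  proof -
    have "f (f i) = i"
    proof -
      have fi: "f i \<in> {1..N}" using f permutes_in_image[OF f] i by blast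
      have "zeta N (f i) = matching u q r s i"
        using matching_parallel[folded N_def, of i] i unfolding fm[OF i(1)] e by simp
      then have "f (f i) = matching u q r s (matching u q r s i)" using fm[OF fi] by simp
      then show ?thesis using matching_involution i by (simp add: N_def)
    qed
    then have "orbit f i = (\<lambda>m. (f ^^ m) i) ` {..<2}"
      by (intro orbit_eq_image) (simp_all add: numeral_2_eq_2)
    then have "card (orbit f i) \<le> 2"
      using card_image_le[of "{..<2::nat}" "\<lambda>m. (f ^^ m) i"] by simp
    moreover have "2 \<le> card (orbit f i)" using two i by (auto simp: Q_def)
    ultimately show ?thesis by simp
  qed
  have en: "e1 \<in> {1..N}" "e2 \<in> {1..N}" "e3 \<in> {1..N}" "e4 \<in> {1..N}" "e5 \<in> {1..N}" "e6 \<in> {1..N}"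
    using u q by (auto simp: e N_def)
  have b: "f e1 = e5" "f e6 = e4" "f e3 = e1" "f e4 = e2"
    using fm en u q
      unfolding zeta_apply[OF en(1)] zeta_apply[OF en(6)] zeta_apply[OF en(3)] zeta_apply[OF en(4)]
    by (auto simp: zeta_apply matching_def e N_def)
  have excess: "(\<Sum>C\<in>Q. card C - 2) = 2"
  proof (cases "r = 0")
    case True
    then have e36: "e3 = e2" "e6 = e5" by (simp_all add: e)
    note b' = b(1,4) b(2)[unfolded e36] b(3)[unfolded e36]
    have "orbit f e1 = (\<lambda>t. (f ^^ t) e1) ` {..<4}"
      by (intro orbit_eq_image) (simp_all add: numeral_eq_Suc b')
    then have o: "orbit f e1 = {e1, e2, e4, e5}"
      by (auto simp: numeral_eq_Suc lessThan_Suc b')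
    have "card (orbit f e1) = 4" unfolding o using u q by (simp add: e)
    moreover have "card C = 2" if C: "C \<in> Q" "C \<noteq> orbit f e1" for C
    proof -
      obtain i where i: "i \<in> {1..N}" "C = orbit f i" using C(1) unfolding Q_def by blast
      have "orbit f e1 \<in> Q" using en by (simp add: Q_def)
      moreover have "i \<in> C" using i permutation_self_in_orbit[OF perm] by simp
      ultimately have "i \<notin> orbit f e1" using block_unique[OF Q C(1)] C(2) by metis
      then show ?thesis using pair[OF i(1)] i(2) unfolding o e36 by simp
    qed
    moreover have "(\<Sum>C\<in>Q. card C - 2) = (\<Sum>C\<in>{orbit f e1}. card C - 2)"
      using en \<open>\<And>C. C \<in> Q \<Longrightarrow> C \<noteq> orbit f e1 \<Longrightarrow> card C = 2\<close>
      by (intro sum.mono_neutral_right) (auto simp: Q_def)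
    ultimately show ?thesis by simp
  next
    case False
    have b': "f e2 = e6" "f e5 = e3"
      using fm en u q False unfolding zeta_apply[OF en(2)] zeta_apply[OF en(5)]
      by (auto simp: zeta_apply matching_def e N_def)
    have "orbit f e1 = (\<lambda>t. (f ^^ t) e1) ` {..<3}"
      by (intro orbit_eq_image) (simp_all add: numeral_eq_Suc b b')
    then have o1: "orbit f e1 = {e1, e5, e3}" by (auto simp: numeral_eq_Suc lessThan_Suc b b')
    have "orbit f e2 = (\<lambda>t. (f ^^ t) e2) ` {..<3}"
      by (intro orbit_eq_image) (simp_all add: numeral_eq_Suc b b')
    then have o2: "orbit f e2 = {e2, e6, e4}" by (auto simp: numeral_eq_Suc lessThan_Suc b b')
    have c3: "card (orbit f e1) = 3" "card (orbit f e2) = 3" "orbit f e1 \<noteq> orbit f e2"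
      unfolding o1 o2 using u q False by (auto simp: e)
    have "card C = 2" if C: "C \<in> Q" "C \<noteq> orbit f e1" "C \<noteq> orbit f e2" for C
    proof -
      obtain i where i: "i \<in> {1..N}" "C = orbit f i" using C(1) unfolding Q_def by blast
      have "orbit f e1 \<in> Q" "orbit f e2 \<in> Q" using en by (simp_all add: Q_def)
      moreover have "i \<in> C" using i permutation_self_in_orbit[OF perm] by simp
      ultimately have "i \<notin> orbit f e1" "i \<notin> orbit f e2"
        using block_unique[OF Q C(1)] C(2,3) by metis+
      then show ?thesis using pair[OF i(1)] i(2) unfolding o1 o2 by simp
    qed
    then have "(\<Sum>C\<in>Q. card C - 2) = (\<Sum>C\<in>{orbit f e1, orbit f e2}. card C - 2)"
      using en by (intro sum.mono_neutral_right) (auto simp: Q_def)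
    then show ?thesis using c3 by simp
  qed
  have "(\<Sum>C\<in>Q. card C - 2) + 2 * card Q = card {1..N}"
    by (rule sum_card_partition_excess[OF Q]) (auto intro: two)
  then have "card Q + 1 = u + q + r + s" using excess by (simp add: N_def)
  then have "(of_nat (u + q + r + s) :: rat) = of_nat (card Q) + 1" by (metis of_nat_1 of_nat_add)
  moreover have
      "num_cycles N (inv (perm_of_partition (matching_partition u q r s)) \<circ> zeta N) = card Q"
    by (simp add: num_cycles_def Q_def f_def kreweras_def)
  ultimately show ?thesis
    unfolding genus_def N_def[symmetric] num_cycles_perm_of_partition[OF P] card_matching_partition
    by (simp add: N_def)
qed

end

text \<open>The partner of 1 determines 2u + q + r. Since \<open>q\<close> is positive, the sum of a
  point and its partner first changes at \<open>Suc u\<close>, which determines \<open>u\<close>;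
  the value there determines \<open>q\<close>.\<close>

lemma matching_inject:
  assumes "1 \<le> u" "1 \<le> q" "1 \<le> u'" "1 \<le> q'" and k: "u + q + r + s = u' + q' + r' + s'"
    and eq: "\<And>i. i \<in> {1..2 * (u + q + r + s)} \<Longrightarrow> matching u q r s i = matching u' q' r' s' i"
  shows "(u, q, r, s) = (u', q', r', s')"
proof -
  have "matching u q r s 1 = matching u' q' r' s' 1" using assms by (intro eq) auto
  then have one: "2 * u + q + r = 2 * u' + q' + r'" using assms(1-5) by (simp add: matching_def)
  have su: "matching u q r s (Suc u) = matching u' q' r' s' (Suc u)" using assms by (intro eq) auto
  have su': "matching u q r s (Suc u') = matching u' q' r' s' (Suc u')" using assms
      by (intro eq) auto
  have "\<not> u < u'" using su assms(1-5) one by (auto simp: matching_def)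
  moreover have "\<not> u' < u" using su' assms(1-5) one by (auto simp: matching_def)
  ultimately have "u = u'" by simp
  moreover have "q = q'" using su assms(1-5) \<open>u = u'\<close> by (simp add: matching_def)
  ultimately show ?thesis using one k by simp
qed

text \<open>Lowering \<open>u\<close> and \<open>q\<close> by one gives the lists of four naturals
  with sum \<open>k - 2\<close>. For \<open>k < 2\<close> both sides vanish.\<close>

lemma card_quadruples:
  "card {(u, q, r, s). 1 \<le> u \<and> 1 \<le> q \<and> u + q + r + s = (k::nat)} = (k + 1) choose 3"
proof (cases "2 \<le> k")
  case False
  then have empty: "{(u, q, r, s). 1 \<le> u \<and> 1 \<le> q \<and> u + q + r + s = (k::nat)} = {}" by auto
  show ?thesis unfolding empty using False by (simp add: binomial_eq_0)
next
  case True
  define L where "L = {l :: nat list. length l = 4 \<and> sum_list l = k - 2}"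
  have "bij_betw (\<lambda>l. (Suc (l ! 0), Suc (l ! 1), l ! 2, l ! 3)) L
      {(u, q, r, s). 1 \<le> u \<and> 1 \<le> q \<and> u + q + r + s = k}"
  proof (rule bij_betw_byWitness[where f' = "\<lambda>(u, q, r, s). [u - 1, q - 1, r, s]"])
    show "\<forall>l\<in>L. (\<lambda>(u, q, r, s). [u - 1, q - 1, r, s]) (Suc (l ! 0), Suc (l ! 1), l ! 2, l ! 3) = l"
      by (auto simp: L_def numeral_eq_Suc length_Suc_conv)
    show "(\<lambda>l. (Suc (l ! 0), Suc (l ! 1), l ! 2, l ! 3)) ` L \<subseteq>
        {(u, q, r, s). 1 \<le> u \<and> 1 \<le> q \<and> u + q + r + s = k}"
      using True by (auto simp: L_def numeral_eq_Suc length_Suc_conv)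
  qed (auto simp: L_def)
  then have "card {(u, q, r, s). 1 \<le> u \<and> 1 \<le> q \<and> u + q + r + s = k} = card L"
    by (simp add: bij_betw_same_card)
  also have "\<dots> = (k - 2 + 4 - 1) choose (k - 2)" unfolding L_def by (rule card_length_sum_list)
  also have "\<dots> = (k + 1) choose (k - 2)" using True by simp
  also have "\<dots> = (k + 1) choose 3" using True by (subst binomial_symmetric) auto
  finally show ?thesis .
qed

definition core_partitions :: "nat \<Rightarrow> nat \<Rightarrow> nat set set set" where
  "core_partitions n k = {P. partition_on {1..n} P \<and> card P = k \<and>
    genus n (perm_of_partition P) = 1 \<and> fully_reduced n P}"

lemma core_partitions_empty: "n \<noteq> 2 * k \<Longrightarrow> core_partitions n k = {}"
  using genus_one_card_eq(1) by (auto simp: core_partitions_def)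

lemma card_core_partitions: "card (core_partitions (2 * k) k) = (k + 1) choose 3"
proof -
  define T where "T = {(u, q, r, s). 1 \<le> u \<and> 1 \<le> q \<and> u + q + r + s = (k::nat)}"
  define h where "h = (\<lambda>(u, q, r, s). matching_partition u q r s)"
  have "core_partitions (2 * k) k = h ` T"
  proof (intro equalityI subsetI)
    fix P assume "P \<in> core_partitions (2 * k) k"
    then have P: "partition_on {1..2 * k} P" "genus (2 * k) (perm_of_partition P) = 1"
        "fully_reduced (2 * k) P" "card P = k"
      by (auto simp: core_partitions_def)
    obtain u q r s where uqrs: "1 \<le> u" "1 \<le> q" "u + q + r + s = card P"
        "\<And>i. i \<in> {1..2 * k} \<Longrightarrow> perm_of_partition P i = matching u q r s i"
      using perm_eq_matching[OF P(1,3,2)] by metis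
    have k: "u + q + r + s = k" using uqrs P by simp
    have "P = matching_partition u q r s"
      using uqrs perm_of_matching_partition[OF uqrs(1,2), of _ r s] partition_on_matching[OF uqrs(1,2), of r s]
      unfolding k by (intro perm_of_partition_inject[OF P(1)]) simp_all
    then show "P \<in> h ` T" using uqrs k by (force simp: h_def T_def)
  next
    fix P assume "P \<in> h ` T"
    then obtain u q r s where uq: "1 \<le> u" "1 \<le> q" and k: "u + q + r + s = k"
        and P: "P = matching_partition u q r s" by (auto simp: h_def T_def)
    show "P \<in> core_partitions (2 * k) k"
      unfolding core_partitions_def P k[symmetric]
      using partition_on_matching[OF uq] card_matching_partition[OF uq] genus_matching[OF uq]
        fully_reduced_matching[OF uq] by blast
  qed
  moreover have "inj_on h T"
  proof (rule inj_onI)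
    fix x y assume xy: "x \<in> T" "y \<in> T" "h x = h y"
    obtain u q r s where x: "x = (u, q, r, s)" by (cases x) auto
    obtain u' q' r' s' where y: "y = (u', q', r', s')" by (cases y) auto
    have 1: "1 \<le> u" "1 \<le> q" "u + q + r + s = k" using xy x by (auto simp: T_def)
    have 2: "1 \<le> u'" "1 \<le> q'" "u' + q' + r' + s' = k" using xy y by (auto simp: T_def)
    have "matching u q r s i = matching u' q' r' s' i" if "i \<in> {1..2 * k}" for i
      using perm_of_matching_partition[OF 1(1,2), of i r s] perm_of_matching_partition[OF 2(1,2), of i r' s']
        that xy(3) unfolding 1(3) 2(3) by (simp add: h_def x y)
    then show "x = y" unfolding x y using 1 2 by (intro matching_inject) auto
  qed
  ultimately show ?thesis using card_quadruples[of k] by (simp add: card_image T_def)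
qed

section \<open>Contraction of runs\<close>

text \<open>
  The elements of \<open>F\<close> cut the cycle \<open>\<zeta>\<^sub>n\<close> into runs, each ending in an element of \<open>F\<close>; the run
  after the last element of \<open>F\<close> wraps around and is the first one.
\<close>

definition run_index :: "nat set \<Rightarrow> nat \<Rightarrow> nat" where
  "run_index F i = (let c = card {f \<in> F. f < i} in if c = card F then 1 else Suc c)"

text \<open>On \<open>F\<close> itself \<open>run_index\<close> is the rank, so this is the
  \<open>a\<close>-th smallest element of \<open>F\<close>, the last point of run
  \<open>a\<close>.\<close>

definition run_end :: "nat set \<Rightarrow> nat \<Rightarrow> nat" where
  "run_end F = inv_into F (run_index F)"

text \<open>This undoes the contraction: each point of \<open>{1..card F}\<close> is blown up to the
  run with that index.\<close>

definition run_partition :: "nat \<Rightarrow> nat set \<Rightarrow> nat set set \<Rightarrow> nat set set" where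
  "run_partition n F P = (\<lambda>B. {i \<in> {1..n}. run_index F i \<in> B}) ` P"

text \<open>These are the points that \<beta> does not fix, hence those that survive the
  contraction.\<close>

definition breaks :: "nat \<Rightarrow> nat set set \<Rightarrow> nat set" where
  "breaks n P = {i \<in> {1..n}. perm_of_partition P i \<noteq> zeta n i}"

context
  fixes n :: nat and F :: "nat set"
  assumes F: "F \<subseteq> {1..n}" "F \<noteq> {}"
begin

lemma finite_F: "finite F"
  using F(1) finite_subset by blast

lemma card_F_pos: "0 < card F"
  using finite_F F(2) by (simp add: card_gt_0_iff)

lemma card_below_le: "card {f \<in> F. f < i} \<le> card F"
  using finite_F by (intro card_mono) auto

lemma run_index_in: "run_index F i \<in> {1..card F}"
  using card_F_pos card_below_le[of i] by (auto simp: run_index_def Let_def)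

lemma run_index_F:
  assumes "f \<in> F"
  shows "run_index F f = Suc (card {x \<in> F. x < f})"
proof -
  have "card {x \<in> F. x < f} < card F" using assms finite_F by (intro psubset_card_mono) auto
  then show ?thesis by (simp add: run_index_def)
qed

lemma less_iff_run_index:
  assumes "f \<in> F"
  shows "f < i \<longleftrightarrow> run_index F f \<le> card {x \<in> F. x < i}"
proof
  assume "f < i"
  then have "insert f {x \<in> F. x < f} \<subseteq> {x \<in> F. x < i}" using assms by auto
  then have "card (insert f {x \<in> F. x < f}) \<le> card {x \<in> F. x < i}"
    using finite_F by (intro card_mono) auto
  then show "run_index F f \<le> card {x \<in> F. x < i}" using run_index_F[OF assms] finite_F by simp
next
  assume "run_index F f \<le> card {x \<in> F. x < i}"
  then have *: "card {x \<in> F. x < f} < card {x \<in> F. x < i}" using run_index_F[OF assms] by simp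
  show "f < i"
  proof (rule ccontr)
    assume "\<not> f < i"
    then have "card {x \<in> F. x < i} \<le> card {x \<in> F. x < f}" using finite_F by (intro card_mono) auto
    then show False using * by simp
  qed
qed

lemma bij_betw_run_index: "bij_betw (run_index F) F {1..card F}"
proof -
  have "inj_on (run_index F) F"
  proof (rule inj_onI)
    fix x y assume xy: "x \<in> F" "y \<in> F" "run_index F x = run_index F y"
    have "\<not> x < y" using less_iff_run_index[OF xy(1), of y] run_index_F[OF xy(2)] xy(3) by simp
    moreover have "\<not> y < x" using less_iff_run_index[OF xy(2), of x] run_index_F[OF xy(1)] xy(3)
        by simp
    ultimately show "x = y" by simp
  qed
  moreover have "run_index F ` F \<subseteq> {1..card F}" using run_index_in by blast
  ultimately show ?thesis
    by (simp add: bij_betw_def card_image card_subset_eq)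
qed

lemma run_end:
  assumes "a \<in> {1..card F}"
  shows "run_end F a \<in> F" "run_index F (run_end F a) = a" "run_end F a \<in> {1..n}"
proof -
  have "a \<in> run_index F ` F" using bij_betw_run_index assms by (simp add: bij_betw_def)
  then show "run_end F a \<in> F" "run_index F (run_end F a) = a"
    unfolding run_end_def by (rule inv_into_into, rule f_inv_into_f)
  then show "run_end F a \<in> {1..n}" using F(1) by blast
qed

lemma run_end_run_index: "f \<in> F \<Longrightarrow> run_end F (run_index F f) = f"
  using bij_betw_run_index unfolding run_end_def bij_betw_def by (simp add: inv_into_f_f)

lemma run_end_less_iff:
  "a \<in> {1..card F} \<Longrightarrow> run_end F a < i \<longleftrightarrow> a \<le> card {x \<in> F. x < i}"
  using less_iff_run_index[OF run_end(1)] run_end(2) by simp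

lemma run_index_zeta:
  assumes i: "i \<in> {1..n}"
  shows "run_index F (zeta n i) = (if i \<in> F then zeta (card F) (run_index F i) else run_index F i)"
proof (cases "i = n")
  case True
  then have z: "zeta n i = 1" using i by (simp add: zeta_apply)
  have empty: "{f \<in> F. f < 1} = {}" using F(1) by auto
  have "run_index F 1 = 1" using card_F_pos unfolding run_index_def Let_def empty by simp
  moreover have "f < n \<longleftrightarrow> f \<noteq> n" if "f \<in> F" for f using F(1) that by fastforce
  then have below: "{f \<in> F. f < n} = F - {n}" by blast
  \<comment> \<open>If \<open>n\<close> is not in \<open>F\<close>, it belongs to the run that wraps
    around, which has index 1, as does the point 1.\<close>
  then have "i \<notin> F \<Longrightarrow> {f \<in> F. f < n} = F" using True by simp
  moreover note below
  then have "i \<in> F \<Longrightarrow> run_index F i = card F"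
    using run_index_F[of i] True finite_F card_F_pos by (simp add: card_Diff_singleton)
  ultimately show ?thesis using run_index_in[of i] True unfolding z
    by (auto simp: zeta_apply run_index_def)
next
  case False
  then have z: "zeta n i = Suc i" using i by (simp add: zeta_apply)
  show ?thesis
  proof (cases "i \<in> F")
    case True
    then have "{f \<in> F. f < Suc i} = insert i {f \<in> F. f < i}" by auto
    then have "card {f \<in> F. f < Suc i} = run_index F i" using run_index_F[OF True] finite_F by simp
    then have "run_index F (Suc i) = (if run_index F i = card F then 1 else Suc (run_index F i))"
      by (simp add: run_index_def[of F "Suc i"])
    then show ?thesis using zeta_apply[OF run_index_in] True z by simp
  next
    case False
    then have "{f \<in> F. f < Suc i} = {f \<in> F. f < i}" by (auto simp: less_Suc_eq)
    then show ?thesis using False z by (simp add: run_index_def)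
  qed
qed

context
  fixes P :: "nat set set"
  assumes P: "partition_on {1..card F} P"
begin

lemma partition_on_run_partition: "partition_on {1..n} (run_partition n F P)"
proof (rule partition_onI)
  show "\<Union> (run_partition n F P) = {1..n}"
  proof (intro equalityI subsetI)
    fix i assume i: "i \<in> {1..n}"
    obtain B where "B \<in> P" "run_index F i \<in> B" using block_exists[OF P run_index_in] .
    then show "i \<in> \<Union> (run_partition n F P)" using i by (auto simp: run_partition_def)
  qed (auto simp: run_partition_def)
  show "{} \<notin> run_partition n F P"
  proof
    assume "{} \<in> run_partition n F P"
    then obtain B where B: "B \<in> P" "{} = {i \<in> {1..n}. run_index F i \<in> B}"
      unfolding run_partition_def by blast
    obtain a where a: "a \<in> B" using B(1) partition_onD3[OF P] by (metis ex_in_conv)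
    then have "a \<in> {1..card F}" using block_subset[OF P B(1)] by blast
    then show False using run_end[of a] a B(2) by auto
  qed
  show "disjnt C D" if CD: "C \<in> run_partition n F P" "D \<in> run_partition n F P" "C \<noteq> D" for C D
  proof -
    obtain B where B: "B \<in> P" "C = {i \<in> {1..n}. run_index F i \<in> B}"
      using CD(1) unfolding run_partition_def by blast
    obtain B' where B': "B' \<in> P" "D = {i \<in> {1..n}. run_index F i \<in> B'}"
      using CD(2) unfolding run_partition_def by blast
    have "B \<inter> B' = {}" using block_unique[OF P B(1) B'(1)] B B' CD(3) by blast
    then show ?thesis unfolding B B' disjnt_def by blast
  qed
qed

lemma image_run_index_pullback:
  assumes "B \<in> P"
  shows "run_index F ` {i \<in> {1..n}. run_index F i \<in> B} = B"
proof (intro equalityI subsetI)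
  fix a assume a: "a \<in> B"
  then have "a \<in> {1..card F}" using block_subset[OF P assms] by blast
  from run_end[OF this] a show "a \<in> run_index F ` {i \<in> {1..n}. run_index F i \<in> B}" by force
qed auto

lemma run_partition_inverse: "(`) (run_index F) ` run_partition n F P = P"
proof -
  have "(\<lambda>B. run_index F ` {i \<in> {1..n}. run_index F i \<in> B}) ` P = (\<lambda>B. B) ` P"
    using image_run_index_pullback by (intro image_cong) auto
  then show ?thesis unfolding run_partition_def image_image by simp
qed

lemma card_run_partition: "card (run_partition n F P) = card P"
proof -
  have "inj_on (\<lambda>B. {i \<in> {1..n}. run_index F i \<in> B}) P"
    using image_run_index_pullback by (metis (no_types, lifting) inj_onI)
  then show ?thesis unfolding run_partition_def by (rule card_image)
qed

lemma perm_run_partition_inside: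
  assumes i: "i \<in> {1..n}" "i \<notin> F"
  shows "perm_of_partition (run_partition n F P) i = zeta n i"
proof -
  obtain B where B: "B \<in> P" "run_index F i \<in> B" using block_exists[OF P run_index_in] .
  have "{i \<in> {1..n}. run_index F i \<in> B} \<in> run_partition n F P" using B
      by (auto simp: run_partition_def)
  then show ?thesis
  proof (rule perm_of_partition_eqI[OF partition_on_run_partition])
    show "i \<in> {i \<in> {1..n}. run_index F i \<in> B}" using i B by simp
    show "zeta n i \<in> {i \<in> {1..n}. run_index F i \<in> B}"
        using run_index_zeta[OF i(1)] i B zeta_in[OF i(1)] by simp
    show "{i \<in> {1..n}. run_index F i \<in> B} \<inter> cyc_gap n i (zeta n i) = {}"
      using i by (auto simp: cyc_gap_def zeta_apply)
  qed
qed

text \<open>The end of run \<open>a\<close> is followed in its block by the first point of run b =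
  \<alpha> a, and that point is the successor of the end of the run preceding
  \<open>b\<close>.\<close>

lemma perm_run_partition_end:
  assumes a: "a \<in> {1..card F}"
  shows "perm_of_partition (run_partition n F P) (run_end F a) =
    zeta n (run_end F (zeta_pred (card F) (perm_of_partition P a)))"
proof -
  define N where "N = card F"
  define b where "b = perm_of_partition P a"
  define p where "p = zeta_pred N b"
  define h where "h = run_end F p"
  obtain B where B: "B \<in> P" "a \<in> B" using block_exists[OF P a] .
  note nxt = perm_of_partition_next[OF P B]
  have b: "b \<in> {1..N}" using perm_in[OF P a] by (simp only: N_def b_def)
  have p: "p \<in> {1..card F}" using zeta_pred_in[OF b] by (simp only: N_def p_def)
  have pb: "p = (if b = 1 then N else b - 1)" by (simp add: p_def zeta_pred_def)
  note h = run_end[OF p, folded h_def] and f = run_end[OF a]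
  have y: "zeta n h = (if h = n then 1 else Suc h)" using zeta_apply[OF h(3)] .
  have C: "{i \<in> {1..n}. run_index F i \<in> B} \<in> run_partition n F P" using B
      by (auto simp: run_partition_def)
  have "zeta (card F) p = b" using zeta_zeta_pred[OF b] by (simp add: p_def N_def)
  then have yC: "zeta n h \<in> {i \<in> {1..n}. run_index F i \<in> B}"
    using run_index_zeta[OF h(3)] h zeta_in[OF h(3)] nxt(1) by (simp add: b_def)
  have "perm_of_partition (run_partition n F P) (run_end F a) = zeta n h"
  proof (rule perm_of_partition_eqI[OF partition_on_run_partition C _ yC])
    show "run_end F a \<in> {i \<in> {1..n}. run_index F i \<in> B}" using f B by simp
    show "{i \<in> {1..n}. run_index F i \<in> B} \<inter> cyc_gap n (run_end F a) (zeta n h) = {}"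
    proof (rule ccontr)
      assume "\<not> ?thesis"
      then obtain z where z: "z \<in> {1..n}" "run_index F z \<in> B"
          "z \<in> cyc_gap n (run_end F a) (zeta n h)"
        by blast
      \<comment> \<open>Through the number \<open>c\<close> of elements of \<open>F\<close> before
        \<open>z\<close>, comparisons of \<open>z\<close> with run ends become comparisons of run
        indices. They show that the run of \<open>z\<close> lies strictly between \<open>a\<close>
        and \<open>b\<close>, against the empty gap in \<open>B\<close>.\<close>
      define c where "c = card {x \<in> F. x < z}"
      have cN: "c \<le> N" using card_below_le by (simp add: c_def N_def)
      have za: "run_end F a < z \<longleftrightarrow> a \<le> c" using run_end_less_iff[OF a] by (simp add: c_def)
      have zp: "h < z \<longleftrightarrow> p \<le> c" using run_end_less_iff[OF p] by (simp add: c_def h_def)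
      have "card {x \<in> F. x < h} = p - 1" using run_index_F[OF h(1)] h(2) by simp
      then have ha: "run_end F a < h \<longleftrightarrow> a < p" using run_end_less_iff[OF a, of h] p by auto
      have ha': "run_end F a = h \<longleftrightarrow> a = p" using f h by (metis h_def)
      have hn: "c < N" if "h = n"
      proof (rule ccontr)
        assume "\<not> c < N"
        then have "h < z" using zp p by (simp add: N_def)
        then show False using z(1) that by simp
      qed
      have pN: "p = N" if "h = n"
      proof (rule ccontr)
        assume "p \<noteq> N"
        then have "p < N" using p by (simp add: N_def)
        then have "run_end F N \<noteq> h" "N \<in> {1..card F}" using run_end[of N] h p by (auto simp: N_def)
        moreover have "run_end F N < Suc n" "\<not> run_end F N < h"
          using run_end(3)[of N] run_end_less_iff[of N h] calculation(2) \<open>card {x \<in> F. x < h} = p - 1\<close> \<open>p < N\<close> by auto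
        ultimately show False using that by simp
      qed
      have idx: "run_index F z = (if c = N then 1 else Suc c)"
          by (simp add: run_index_def c_def N_def)
      have "run_index F z \<in> cyc_gap N a b"
      proof (cases "h = n")
        case True
        have "b = 1" using pN[OF True] pb b by (auto split: if_splits)
        then show ?thesis using z(3) za hn[OF True] idx True a z(1) unfolding y
          by (auto simp: cyc_gap_def)
      next
        case False
        have "z < Suc h \<longleftrightarrow> c < p" using zp by auto
        moreover have "run_end F a < Suc h \<longleftrightarrow> a \<le> p" using ha ha' by (auto simp: less_Suc_eq)
        ultimately have "if a \<le> p then a \<le> c \<and> c < p else a \<le> c \<or> c < p"
          using z(3) False za unfolding y by (simp add: cyc_gap_def split: if_splits)
        then show ?thesis using idx cN a b p pb unfolding cyc_gap_def N_def[symmetric]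
          by (auto split: if_splits)
      qed
      then show False using z(2) nxt(2) by (auto simp: b_def N_def)
    qed
  qed
  then show ?thesis by (simp add: h_def p_def b_def N_def)
qed

lemma kreweras_run_partition_inside:
  "i \<in> {1..n} \<Longrightarrow> i \<notin> F \<Longrightarrow> kreweras n (run_partition n F P) i = i"
  unfolding kreweras_eq_iff[OF partition_on_run_partition] by (rule perm_run_partition_inside)

text \<open>On \<open>F\<close>, the \<beta> of the expanded partition is a relabelled copy of the
  \<beta> of \<open>P\<close>; outside \<open>F\<close> it is the identity.\<close>

lemma kreweras_run_partition_end:
  assumes a: "a \<in> {1..card F}"
  shows "kreweras n (run_partition n F P) (run_end F a) = run_end F (kreweras (card F) P a)"
  unfolding kreweras_eq_iff[OF partition_on_run_partition]
    perm_run_partition_end[OF kreweras_in[OF P a]] perm_kreweras[OF P] zeta_pred_zeta[OF a] ..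

lemma run_end_inject:
  "a \<in> {1..card F} \<Longrightarrow> b \<in> {1..card F} \<Longrightarrow> run_end F a = run_end F b \<longleftrightarrow> a = b"
  using run_end(2) by metis

text \<open>Expansion keeps the number of blocks and adds one fixed point of \<beta> for every point
  outside \<open>F\<close>. This is also the growth of the ground set, so the two changes cancel in
  the genus.\<close>

lemma genus_run_partition:
  "genus n (perm_of_partition (run_partition n F P)) = genus (card F) (perm_of_partition P)"
proof -
  define N where "N = card F"
  define f where "f = kreweras n (run_partition n F P)"
  define f' where "f' = kreweras N P"
  have f': "f' permutes {1..N}" using kreweras_permutes[OF P] by (simp add: f'_def N_def)
  have perm: "permutation f'" using f' by (auto simp: permutation_permutes)
  have sub: "orbit f' a \<subseteq> {1..N}" if "a \<in> {1..N}" for a using permutes_orbit_subset[OF f' that] .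
  have orb: "orbit f (run_end F a) = run_end F ` orbit f' a" if a: "a \<in> {1..N}" for a
  proof (rule orbit_inverse[symmetric])
    show "a \<in> orbit f' a" using permutation_self_in_orbit[OF perm] .
    show "f (run_end F x) = run_end F (f' x)" if "x \<in> orbit f' a" for x
      using kreweras_run_partition_end[of x] sub[OF a] that by (auto simp: f_def f'_def N_def)
  qed
  have FN: "F = run_end F ` {1..N}"
    using run_end(1) run_end_run_index run_index_in unfolding N_def
      by (metis (no_types, lifting) image_eqI image_subsetI subsetI subset_antisym)
  have inj: "inj_on (run_end F) {1..N}" using run_end_inject by (auto simp: inj_on_def N_def)
  have "orbit f ` F = (`) (run_end F) ` (orbit f' ` {1..N})"
    by (subst FN) (simp add: image_image orb)
  moreover have "inj_on ((`) (run_end F)) (orbit f' ` {1..N})"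
    using sub inj by (intro inj_onI) (auto simp: inj_on_image_eq_iff)
  ultimately have c1: "card (orbit f ` F) = card (orbit f' ` {1..N})" by (simp add: card_image)
  have single: "orbit f i = {i}" if "i \<in> {1..n} - F" for i
    using kreweras_run_partition_inside that by (simp add: orbit_eq_singleton_iff f_def)
  then have "orbit f ` ({1..n} - F) = (\<lambda>i. {i}) ` ({1..n} - F)" by (rule image_cong[OF refl])
  then have c2: "card (orbit f ` ({1..n} - F)) = n - N"
    using F(1) finite_F by (simp add: card_image card_Diff_subset N_def)
  have "orbit f ` F \<inter> orbit f ` ({1..n} - F) = {}"
  proof (rule ccontr)
    assume "\<not> ?thesis"
    then obtain x i where x: "x \<in> F" and i: "i \<in> {1..n} - F" and xi: "orbit f x = orbit f i"
        by blast
    obtain a where a: "a \<in> {1..N}" "x = run_end F a" using FN x by blast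
    have "run_end F ` orbit f' a = {i}" using orb[OF a(1)] xi single[OF i] a(2) by simp
    then have "i \<in> F" using FN sub[OF a(1)] by blast
    then show False using i by blast
  qed
  then have "card (orbit f ` F \<union> orbit f ` ({1..n} - F)) = card (orbit f' ` {1..N}) + (n - N)"
    using c1 c2 finite_F by (subst card_Un_disjoint) auto
  moreover have "orbit f ` {1..n} = orbit f ` F \<union> orbit f ` ({1..n} - F)" using F(1) by blast
  ultimately have cyc: "num_cycles n f = num_cycles N f' + (n - N)" by (simp add: num_cycles_def)
  have "N \<le> n" using card_mono[OF _ F(1)] by (simp add: N_def)
  then have "(of_nat (num_cycles n f) :: rat) = of_nat (num_cycles N f') + (of_nat n - of_nat N)"
    unfolding cyc by (simp add: of_nat_diff)
  then show ?thesis
    unfolding genus_def num_cycles_perm_of_partition[OF P] kreweras_def[symmetric]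
      num_cycles_perm_of_partition[OF partition_on_run_partition] card_run_partition
    by (simp add: f_def f'_def N_def)
qed

text \<open>If the end of run \<open>a\<close> were followed by its own successor, then \<alpha> a =
  \<open>zeta (card F) a\<close>, which full reducedness excludes. Hence \<open>F\<close> can be
  recovered from the expanded partition.\<close>

lemma breaks_run_partition:
  assumes "fully_reduced (card F) P"
  shows "breaks n (run_partition n F P) = F"
proof -
  have "perm_of_partition (run_partition n F P) i \<noteq> zeta n i" if i: "i \<in> F" for i
  proof -
    define a where "a = run_index F i"
    have a: "a \<in> {1..card F}" using run_index_in by (simp only: a_def)
    have ia: "i = run_end F a" using run_end_run_index[OF i] by (simp add: a_def)
    define b where "b = perm_of_partition P a"
    have b: "b \<in> {1..card F}" "b \<noteq> zeta (card F) a"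
      using perm_in[OF P a] assms a unfolding fully_reduced_def b_def by blast+
    have "zeta_pred (card F) b \<noteq> a" using zeta_zeta_pred[OF b(1)] b(2) by metis
    then show ?thesis
      unfolding ia perm_run_partition_end[OF a] b_def[symmetric] zeta_inject
      using run_end_inject zeta_pred_in[OF b(1)] a by blast
  qed
  then show ?thesis using perm_run_partition_inside F(1) by (auto simp: breaks_def)
qed

end

end

section \<open>Trivial cycles in terms of breaks\<close>

lemma trivial_cycle_zeta:
  assumes "i \<in> {1..n}" "t < p"
  shows "map (\<lambda>j. (i + j - 1) mod n + 1) [0..<p] ! t = (zeta n ^^ t) i"
  using assms by (simp add: zeta_funpow)

text \<open>In a trivial cycle only the last entry can be a break. Conversely, a block with at most
  one break is traversed by \<open>zeta n\<close> up to that break, so it is a trivial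
  cycle.\<close>

lemma reduced_partition_iff:
  assumes P: "partition_on {1..n} P" and n: "1 \<le> n"
  shows "reduced_partition n P \<longleftrightarrow> (\<forall>B \<in> P. \<not> (\<exists>f. B \<inter> breaks n P \<subseteq> {f}))"
proof -
  define al where "al = perm_of_partition P"
  have "\<exists>B \<in> P. \<exists>f. B \<inter> breaks n P \<subseteq> {f}" if cs: "is_cycle_of cs al" "trivial_cycle n cs" for cs
  proof -
    obtain i p where i: "i \<in> {1..n}" and p: "p < n"
      and cs_eq: "cs = map (\<lambda>j. (i + j - 1) mod n + 1) [0..<Suc p]"
      using cs(2) unfolding trivial_cycle_def by blast
    have len: "length cs = Suc p" by (simp add: cs_eq)
    have nth: "cs ! t = (zeta n ^^ t) i" if "t < Suc p" for t
      unfolding cs_eq by (rule trivial_cycle_zeta[OF i that])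
    have dist: "distinct cs" using cs(1) by (simp add: is_cycle_of_def)
    have al: "al (cs ! t) = cs ! (Suc t mod Suc p)" if "t < Suc p" for t
      using cs(1) cycle_of_list_nth[OF dist, of t] that len by (simp add: is_cycle_of_def)
    obtain B where B: "B \<in> P" "i \<in> B" using block_exists[OF P i] .
    have "B \<subseteq> set cs"
    proof
      fix c assume "c \<in> B"
      then have "c \<in> orbit al i" using orbit_perm_of_partition[OF P B] by (simp add: al_def)
      then show "c \<in> set cs"
      proof induction
        case base
        have "al i = cs ! (Suc 0 mod Suc p)" using al[of 0] nth[of 0] by simp
        then show ?case using len by (simp add: nth_mem)
      next
        case (step c)
        then obtain t where t: "t < Suc p" "c = cs ! t" using len by (metis in_set_conv_nth)
        then show ?case using al[OF t(1)] len by (simp add: nth_mem)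
      qed
    qed
    moreover have "cs ! t \<notin> breaks n P" if "t < p" for t
      using al[of t] nth[of t] nth[of "Suc t"] that by (simp add: breaks_def al_def)
    ultimately have "B \<inter> breaks n P \<subseteq> {cs ! p}"
      using len by (force simp: in_set_conv_nth less_Suc_eq)
    then show ?thesis using B by blast
  qed
  moreover have "\<exists>cs. is_cycle_of cs al \<and> trivial_cycle n cs"
    if B: "B \<in> P" "B \<inter> breaks n P \<subseteq> {f}" for B f
  proof -
    have Bn: "B \<subseteq> {1..n}" using block_subset[OF P B(1)] .
    have step: "al x = zeta n x" if "x \<in> B" "x \<noteq> f" for x
    proof (rule ccontr)
      assume "al x \<noteq> zeta n x"
      then have "x \<in> breaks n P" using that(1) Bn by (auto simp: breaks_def al_def)
      then show False using that B(2) by blast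
    qed
    have closed: "al x \<in> B" if "x \<in> B" for x
      using perm_of_partition_next(1)[OF P B(1) that] by (simp add: al_def)
    \<comment> \<open>The common construction: a walk along \<open>zeta n\<close> that does not meet
      \<open>f\<close> before step \<open>p\<close>, and that \<alpha> closes up after step
      \<open>p\<close>, is a trivial cycle.\<close>
    have main: ?thesis
      if i: "i \<in> B" and p: "p < n" and inner: "\<And>t. t < p \<Longrightarrow> (zeta n ^^ t) i \<noteq> f"
        and last: "al ((zeta n ^^ p) i) = i" for i p
    proof -
      define cs where "cs = map (\<lambda>j. (i + j - 1) mod n + 1) [0..<Suc p]"
      have inn: "i \<in> {1..n}" using i Bn by blast
      have len: "length cs = Suc p" by (simp add: cs_def)
      have nth: "cs ! t = (zeta n ^^ t) i" if "t < Suc p" for t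
        unfolding cs_def by (rule trivial_cycle_zeta[OF inn that])
      have inB: "(zeta n ^^ t) i \<in> B" if "t \<le> p" for t
        using that
      proof (induction t)
        case (Suc t)
        then show ?case using closed[of "(zeta n ^^ t) i"] step[of "(zeta n ^^ t) i"] inner[of t]
            by simp
      qed (use i in simp)
      have "distinct cs"
        unfolding distinct_conv_nth len
      proof (intro allI impI)
        fix s t assume st: "s < Suc p" "t < Suc p" "s \<noteq> t"
        have *: "(zeta n ^^ a) i \<noteq> (zeta n ^^ b) i" if "a < b" "b < n" for a b
        proof
          assume eq: "(zeta n ^^ a) i = (zeta n ^^ b) i"
          have "(zeta n ^^ (b - a + a)) i = (zeta n ^^ (b - a)) ((zeta n ^^ a) i)"
            by (simp only: funpow_add comp_apply)
          moreover have "b - a + a = b" using that by simp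
          ultimately have "(zeta n ^^ (b - a)) ((zeta n ^^ a) i) = (zeta n ^^ a) i"
            using eq by simp
          then show False using zeta_funpow_neq[OF zeta_funpow_in[OF inn], of "b - a"] that by simp
        qed
        show "cs ! s \<noteq> cs ! t"
          unfolding nth[OF st(1)] nth[OF st(2)]
        proof (cases "s < t")
          case True
          show "(zeta n ^^ s) i \<noteq> (zeta n ^^ t) i" by (rule *[OF True]) (use st p in linarith)
        next
          case False
          then have less: "t < s" using st by simp
          show "(zeta n ^^ s) i \<noteq> (zeta n ^^ t) i"
              by (rule *[OF less, symmetric]) (use st p in linarith)
        qed
      qed
      moreover have "al x = cycle_of_list cs x" if x: "x \<in> set cs" for x
      proof -
        obtain t where t: "t < Suc p" "x = cs ! t" using x len by (metis in_set_conv_nth)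
        have c: "cycle_of_list cs x = cs ! (Suc t mod Suc p)"
          using cycle_of_list_nth[OF \<open>distinct cs\<close>, of t] t len by simp
        show ?thesis
        proof (cases "t = p")
          case True
          then show ?thesis using c last t nth[of p] nth[of 0] by simp
        next
          case False
          then have "t < p" using t by simp
          then show ?thesis using c t nth[of t] nth[of "Suc t"] step[OF inB[of t] inner[of t]]
              by simp
        qed
      qed
      moreover have "cs \<noteq> []" using len by auto
      moreover have "trivial_cycle n cs" using inn p unfolding trivial_cycle_def cs_def by blast
      ultimately show ?thesis unfolding is_cycle_of_def by blast
    qed
    \<comment> \<open>If \<open>f\<close> is in the block, the walk leads from \<alpha> f to
      \<open>f\<close>, with \<open>p = 0\<close> at a fixed point. Otherwise \<alpha> agrees with
      \<open>zeta n\<close> on the whole block, and the walk runs once around with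
      \<open>p = n - 1\<close>.\<close>
    show ?thesis
    proof (cases "f \<in> B")
      case True
      have al: "al f \<in> {1..n}" "f \<in> {1..n}" using closed[OF True] Bn True by auto
      show ?thesis
      proof (cases "al f = f")
        case True
        then show ?thesis using main[of f 0] \<open>f \<in> B\<close> n by simp
      next
        case False
        obtain t where t: "0 < t" "t < n" "(zeta n ^^ t) (al f) = f"
          "\<And>s. 0 < s \<Longrightarrow> s < t \<Longrightarrow> (zeta n ^^ s) (al f) \<in> cyc_gap n (al f) f"
          using zeta_funpow_reach[OF al False] by blast
        have "(zeta n ^^ s) (al f) \<noteq> f" if "s < t" for s
        proof (cases "s = 0")
          case True
          then show ?thesis using \<open>al f \<noteq> f\<close> by simp
        next
          case False
          then show ?thesis using t(4)[of s] that by (auto simp: cyc_gap_def split: if_splits)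
        qed
        then show ?thesis using main[OF closed[OF \<open>f \<in> B\<close>] t(2)] t(3) by simp
      qed
    next
      case False
      then have all: "al x = zeta n x" if "x \<in> B" for x using step that by blast
      obtain i where i: "i \<in> B" using B(1) partition_onD3[OF P] by (metis ex_in_conv)
      have inB: "(zeta n ^^ t) i \<in> B" for t
      proof (induction t)
        case (Suc t)
        then show ?case using all closed by (metis comp_apply funpow.simps(2))
      qed (use i in simp)
      have inn: "i \<in> {1..n}" using i Bn by blast
      have "al ((zeta n ^^ (n - 1)) i) = (zeta n ^^ n) i"
        using all[OF inB] n
          by (metis Suc_diff_1 comp_apply funpow.simps(2) less_le_trans zero_less_one)
      also have "\<dots> = i" using inn unfolding zeta_funpow[OF inn] by (cases i) auto
      finally show ?thesis using main[OF i, of "n - 1"] n inB False by auto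
    qed
  qed
  ultimately show ?thesis unfolding reduced_partition_def al_def by blast
qed

section \<open>Enumeration\<close>

text \<open>Walk from \<open>i\<close> along \<open>zeta n\<close> to the first break. Before it
  \<alpha> and \<open>zeta n\<close> agree, so the walk stays in the block as well as in the
  run.\<close>

lemma run_end_in_block:
  assumes P: "partition_on {1..n} P" and ne: "breaks n P \<noteq> {}" and B: "B \<in> P" "i \<in> B"
  shows "run_end (breaks n P) (run_index (breaks n P) i) \<in> B"
proof -
  define F where "F = breaks n P"
  have F: "F \<subseteq> {1..n}" "F \<noteq> {}" using ne by (auto simp: F_def breaks_def)
  have i: "i \<in> {1..n}" using B block_subset[OF P] by blast
  have walk: "(zeta n ^^ t) i \<in> B \<and> run_index F ((zeta n ^^ t) i) = run_index F i"
    if "\<And>s. s < t \<Longrightarrow> (zeta n ^^ s) i \<notin> F" for t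
    using that
  proof (induction t)
    case 0
    then show ?case using B by simp
  next
    case (Suc t)
    define x where "x = (zeta n ^^ t) i"
    have x: "x \<in> {1..n}" "x \<notin> F" "x \<in> B" "run_index F x = run_index F i"
      using zeta_funpow_in[OF i] Suc.prems[of t] Suc.IH Suc.prems by (simp_all add: x_def)
    have "zeta n x = perm_of_partition P x" using x by (simp add: F_def breaks_def)
    then have "zeta n x \<in> B" using perm_of_partition_next(1)[OF P B(1) x(3)] by simp
    moreover have "run_index F (zeta n x) = run_index F i" using run_index_zeta[OF F x(1)] x by simp
    ultimately show ?case by (simp add: x_def)
  qed
  have "\<exists>t. (zeta n ^^ t) i \<in> F"
  proof (cases "i \<in> F")
    case True
    then show ?thesis by (intro exI[of _ 0]) simp
  next
    case False
    obtain f where f: "f \<in> F" using F by blast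
    then have "f \<in> {1..n}" "i \<noteq> f" using F False by auto
    then show ?thesis using zeta_funpow_reach[OF i] f by metis
  qed
  define t where "t = (LEAST t. (zeta n ^^ t) i \<in> F)"
  have t: "(zeta n ^^ t) i \<in> F" unfolding t_def using \<open>\<exists>t. _ t\<close> by (rule LeastI_ex)
  have "(zeta n ^^ s) i \<notin> F" if "s < t" for s using not_less_Least that unfolding t_def by blast
  then have "(zeta n ^^ t) i \<in> B" "run_index F ((zeta n ^^ t) i) = run_index F i" using walk
      by blast+
  then show ?thesis using run_end_run_index[OF F t] by (simp add: F_def)
qed

lemma reduced_eq_run_partition:
  assumes P: "partition_on {1..n} P" and n: "1 \<le> n" and red: "reduced_partition n P"
  obtains P' where "partition_on {1..card (breaks n P)} P'" "fully_reduced (card (breaks n P)) P'"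
    "P = run_partition n (breaks n P) P'" "breaks n P \<noteq> {}" "breaks n P \<subseteq> {1..n}"
proof -
  define F where "F = breaks n P"
  define N where "N = card F"
  have many: "\<not> B \<inter> F \<subseteq> {f}" if "B \<in> P" for B f
    using red that unfolding reduced_partition_iff[OF P n] F_def by blast
  obtain B0 where "B0 \<in> P" "1 \<in> B0" using block_exists[OF P, of 1] n by auto
  then have F: "F \<subseteq> {1..n}" "F \<noteq> {}" using many by (auto simp: F_def breaks_def)
  note home = run_end_in_block[OF P F(2)[unfolded F_def], folded F_def]
  \<comment> \<open>The break at the end of a run lies in the block of each point of the run, so no
    run meets two blocks. This makes the images of the blocks under \<open>run_index\<close> a
    partition.\<close>
  have same: "B = C" if "B \<in> P" "C \<in> P" "i \<in> B" "j \<in> C" "run_index F i = run_index F j" for B C i j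
    using block_unique[OF P that(1,2)] home[OF that(1,3)] home[OF that(2,4)] that(5) by simp
  have pullback: "{i \<in> {1..n}. run_index F i \<in> run_index F ` B} = B" if "B \<in> P" for B
  proof (intro equalityI subsetI)
    fix i assume "i \<in> {i \<in> {1..n}. run_index F i \<in> run_index F ` B}"
    then obtain j where i: "i \<in> {1..n}" and j: "j \<in> B" "run_index F i = run_index F j" by blast
    obtain C where C: "C \<in> P" "i \<in> C" using block_exists[OF P i] .
    show "i \<in> B" using same[OF C(1) that C(2) j] C by simp
  qed (use block_subset[OF P that] in auto)
  define P' where "P' = (`) (run_index F) ` P"
  have P': "partition_on {1..N} P'"
  proof (rule partition_onI)
    have "\<Union> P' = run_index F ` {1..n}" using partition_onD1[OF P] by (auto simp: P'_def)
    also have "\<dots> = {1..N}"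
    proof
      show "run_index F ` {1..n} \<subseteq> {1..N}" using run_index_in[OF F] unfolding N_def by blast
      show "{1..N} \<subseteq> run_index F ` {1..n}"
        using run_end(2,3)[OF F] unfolding N_def by (metis image_eqI subsetI)
    qed
    finally show "\<Union> P' = {1..N}" .
    show "{} \<notin> P'" using partition_onD3[OF P] by (auto simp: P'_def)
    show "disjnt C D" if CD: "C \<in> P'" "D \<in> P'" "C \<noteq> D" for C D
    proof -
      obtain A where A: "A \<in> P" "C = run_index F ` A" using CD(1) unfolding P'_def by blast
      obtain B where B: "B \<in> P" "D = run_index F ` B" using CD(2) unfolding P'_def by blast
      show ?thesis using same[OF A(1) B(1)] CD(3) unfolding A B disjnt_def by blast
    qed
  qed
  have eq: "P = run_partition n F P'"
    unfolding run_partition_def P'_def image_image using pullback by simp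
  have "fully_reduced N P'"
    unfolding fully_reduced_def
  proof (intro ballI conjI)
    fix a assume a: "a \<in> {1..N}"
    note e = run_end[OF F a[unfolded N_def]]
    obtain B where B: "B \<in> P'" "a \<in> B" using block_exists[OF P' a] .
    show "perm_of_partition P' a \<noteq> a"
    proof
      assume "perm_of_partition P' a = a"
      \<comment> \<open>A fixed point of the contracted permutation comes from a block that is a
        single run. It would contain one break only, against reducedness.\<close>
      then have Ba: "B = {a}" using orbit_perm_of_partition[OF P' B] orbit_eq_singleton_iff by metis
      have "{i \<in> {1..n}. run_index F i \<in> B} \<in> P" using B(1) eq by (auto simp: run_partition_def)
      then obtain f where f: "f \<in> F" "run_index F f = a" "f \<noteq> run_end F a"
        using many[of _ "run_end F a"] unfolding Ba by blast
      then show False using run_end_run_index[OF F f(1)] by simp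
    qed
    show "perm_of_partition P' a \<noteq> zeta N a"
    proof
      assume *: "perm_of_partition P' a = zeta N a"
      have "perm_of_partition P (run_end F a) = zeta n (run_end F a)"
        using perm_run_partition_end[OF F P'[unfolded N_def] a[unfolded N_def]] *
          zeta_pred_zeta[OF a] eq by (simp add: N_def)
      then show False using e(1) by (simp add: F_def breaks_def)
    qed
  qed
  from that[folded F_def, folded N_def, OF P' this eq F(2,1)] show ?thesis .
qed

text \<open>Expansion is a bijection from pairs of a \<open>2 * k\<close>-subset \<open>F\<close> of
  \<open>{1..n}\<close> and a contracted partition with \<open>k\<close> blocks. It also yields the
  value 0 for \<open>n = 0\<close> or \<open>k = 0\<close>, which \<open>R0\<close>
  requires.\<close>

lemma r0_eq: "r0 n k = (n choose (2 * k)) * ((k + 1) choose 3)"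
proof (cases "n = 0 \<or> k = 0")
  case True
  \<comment> \<open>Only the empty partition of the empty set is left, and its genus is 1/2.\<close>
  have "\<not> (partition_on {1..n} P \<and> card P = k \<and> genus n (perm_of_partition P) = 1)" for P
  proof
    assume P: "partition_on {1..n} P \<and> card P = k \<and> genus n (perm_of_partition P) = 1"
    then have "finite P" using finite_elements[of "{1..n}" P] by simp
    then have "P = {}" using P True by (auto simp: partition_on_empty)
    then have "n = 0" using P by (auto simp: partition_on_def)
    then show False using P by (simp add: genus_def num_cycles_def)
  qed
  then have none: "{P. partition_on {1..n} P \<and> card P = k \<and> genus n (perm_of_partition P) = 1 \<and>
      reduced_partition n P} = {}"
    by blast
  show ?thesis unfolding r0_def none using True by auto
next
  case False
  then have n: "1 \<le> n" and k: "1 \<le> k" by auto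
  define S where "S = {P. partition_on {1..n} P \<and> card P = k \<and>
    genus n (perm_of_partition P) = 1 \<and> reduced_partition n P}"
  define T where "T = {F. F \<subseteq> {1..n} \<and> card F = 2 * k} \<times> core_partitions (2 * k) k"
  have T: "F \<subseteq> {1..n}" "F \<noteq> {}" "card F = 2 * k" "partition_on {1..card F} P" "card P = k"
    "genus (card F) (perm_of_partition P) = 1" "fully_reduced (card F) P"
    if "(F, P) \<in> T" for F P
    using that k by (auto simp: T_def core_partitions_def)
  have "S = (\<lambda>(F, P). run_partition n F P) ` T"
  proof (intro equalityI subsetI)
    fix P assume "P \<in> S"
    then have P: "partition_on {1..n} P" "card P = k" "genus n (perm_of_partition P) = 1"
        "reduced_partition n P" by (auto simp: S_def)
    define F where "F = breaks n P"
    obtain P' where P': "partition_on {1..card F} P'" "fully_reduced (card F) P'"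
        "P = run_partition n F P'" and F: "F \<subseteq> {1..n}" "F \<noteq> {}"
      using reduced_eq_run_partition[OF P(1) n P(4)] unfolding F_def by metis
    have "card P' = k" using card_run_partition[OF F P'(1)] P(2) P'(3) by simp
    moreover have "genus (card F) (perm_of_partition P') = 1"
      using genus_run_partition[OF F P'(1)] P(3) P'(3) by simp
    ultimately have core: "P' \<in> core_partitions (card F) k" using P'
        by (simp add: core_partitions_def)
    then have "card F = 2 * k" using core_partitions_empty[of "card F" k] by auto
    then have "(F, P') \<in> T" using core F by (simp add: T_def)
    then show "P \<in> (\<lambda>(F, P). run_partition n F P) ` T" using P'(3) by force
  next
    fix Q assume "Q \<in> (\<lambda>(F, P). run_partition n F P) ` T"
    then obtain F P where FP: "(F, P) \<in> T" and Q: "Q = run_partition n F P" by auto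
    note t = T[OF FP]
    note part = partition_on_run_partition[OF t(1,2,4)]
    have "reduced_partition n Q"
      unfolding Q reduced_partition_iff[OF part n] breaks_run_partition[OF t(1,2,4,7)]
    proof (intro ballI notI)
      fix C assume "C \<in> run_partition n F P" "\<exists>f. C \<inter> F \<subseteq> {f}"
      then obtain B f where B: "B \<in> P" and C: "C = {i \<in> {1..n}. run_index F i \<in> B}"
          and f: "C \<inter> F \<subseteq> {f}" unfolding run_partition_def by blast
      obtain a where a: "a \<in> B" using B partition_onD3[OF t(4)] by (metis ex_in_conv)
      define b where "b = perm_of_partition P a"
      have b: "b \<in> B" using perm_of_partition_next(1)[OF t(4) B a] by (simp add: b_def)
      have ab: "a \<in> {1..card F}" "b \<in> {1..card F}" using a b block_subset[OF t(4) B] by auto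
      \<comment> \<open>The contracted block contains the two distinct points \<open>a\<close> and
        \<alpha> a, so the expanded block contains two breaks.\<close>
      have "a \<noteq> b" using t(7) ab(1) unfolding fully_reduced_def b_def by metis
      have "run_end F a \<in> C \<inter> F" "run_end F b \<in> C \<inter> F"
        using run_end[OF t(1,2) ab(1)] run_end[OF t(1,2) ab(2)] a b by (auto simp: C)
      then have "run_end F a = run_end F b" using f by blast
      then show False using run_end_inject[OF t(1,2,4) ab] \<open>a \<noteq> b\<close> by simp
    qed
    then show "Q \<in> S"
      using part card_run_partition[OF t(1,2,4)] genus_run_partition[OF t(1,2,4)] t(5,6)
      by (simp add: S_def Q)
  qed
  moreover have "inj_on (\<lambda>(F, P). run_partition n F P) T"
  proof (rule inj_onI, clarify)
    fix F P F' P' assume FP: "(F, P) \<in> T" "(F', P') \<in> T" and eq: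
        "run_partition n F P = run_partition n F' P'"
    note t = T[OF FP(1)] and t' = T[OF FP(2)]
    have F: "F = F'"
      using breaks_run_partition[OF t(1,2,4,7)] breaks_run_partition[OF t'(1,2,4,7)]
      unfolding eq by (rule trans[OF sym])
    have "P = (`) (run_index F) ` run_partition n F P"
      by (rule run_partition_inverse[OF t(1,2,4), symmetric])
    also have "\<dots> = (`) (run_index F') ` run_partition n F' P'" by (subst eq) (simp only: F)
    also have "\<dots> = P'" by (rule run_partition_inverse[OF t'(1,2,4)])
    finally have "P = P'" .
    with F show "F = F' \<and> P = P'" by simp
  qed
  ultimately have "card S = card T" by (simp add: card_image)
  also have "\<dots> = (n choose (2 * k)) * ((k + 1) choose 3)"
    using n_subsets[of "{1..n}" "2 * k"] card_core_partitions[of k]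
      by (simp add: T_def card_cartesian_product)
  finally show ?thesis by (simp add: r0_def S_def)
qed

section \<open>The generating function\<close>

definition choose_series :: "(nat \<Rightarrow> rat) \<Rightarrow> rat fps fps" where
  "choose_series c = Abs_fps (\<lambda>n. Abs_fps (\<lambda>k. of_nat (n choose (2 * k)) * c k))"

text \<open>By Pascal's rule, the second difference of (n choose 2k + 2) in \<open>n\<close> is (n
  choose 2k). So (1 - x)^2 turns the coefficient of \<open>c (Suc k)\<close> into the one that y x^2
  gives to \<open>c k\<close>. The terms with \<open>k = 0\<close> are geometric series and leave (1
  - x) c(0).\<close>

lemma choose_series_step:
  "((1 - var_x) ^ 2 - var_y * var_x ^ 2) * choose_series c =
    (1 - var_x) * fps_const (fps_const (c 0)) + var_y * var_x ^ 2 * choose_series (\<lambda>k. c (Suc k) - c k)"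
proof -
  have "((1 - var_x) ^ 2 - var_y * var_x ^ 2) * choose_series c =
      choose_series c - 2 * (var_x * choose_series c) + var_x * (var_x * choose_series c) -
      var_y * (var_x * (var_x * choose_series c))"
    by (simp add: power2_eq_square algebra_simps)
  also have "\<dots> = fps_const (fps_const (c 0)) - var_x * fps_const (fps_const (c 0)) +
      var_y * (var_x * (var_x * choose_series (\<lambda>k. c (Suc k) - c k)))"
  proof (intro fps_ext)
    fix n k
    have two: "fps_nth (2 * f) n = 2 * fps_nth f n" "fps_nth (2 * h) n = 2 * fps_nth h n"
      for f :: "rat fps fps" and h :: "rat fps" and n
      by (simp_all only: mult_2 fps_add_nth)
    show "fps_nth (fps_nth (choose_series c - 2 * (var_x * choose_series c) + var_x * (var_x * choose_series c) -
        var_y * (var_x * (var_x * choose_series c))) n) k =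
        fps_nth (fps_nth (fps_const (fps_const (c 0)) - var_x * fps_const (fps_const (c 0)) +
        var_y * (var_x * (var_x * choose_series (\<lambda>k. c (Suc k) - c k)))) n) k"
    proof (cases n)
      case 0
      then show ?thesis by (cases k) (simp_all add: two choose_series_def)
    next
      case n: (Suc n')
      show ?thesis
      proof (cases n')
        case 0
        then show ?thesis unfolding n by (cases k) (simp_all add: two choose_series_def)
      next
        case (Suc m)
        then show ?thesis unfolding n
            by (cases k) (simp_all add: two choose_series_def algebra_simps)
      qed
    qed
  qed
  also have "\<dots> = (1 - var_x) * fps_const (fps_const (c 0)) +
      var_y * var_x ^ 2 * choose_series (\<lambda>k. c (Suc k) - c k)"
    by (simp add: power2_eq_square algebra_simps)
  finally show ?thesis .
qed

text \<open>With \<open>c k = (Suc k choose j)\<close>, differencing lowers \<open>j\<close> by one,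
  so multiplying by \<open>D\<close> steps from \<open>S 3\<close> down to \<open>S 0\<close>, where
  the difference is zero. The boundary value (1 choose j) is 0 for \<open>j = 3\<close> and
  \<open>j = 2\<close>, and 1 for \<open>j = 1\<close> and \<open>j = 0\<close>.\<close>

lemma R0_eq:
  "R0 = (var_y ^ 2 * var_x ^ 4 * (1 - var_x) ^ 3) / ((1 - var_x) ^ 2 - var_y * var_x ^ 2) ^ 4"
proof -
  define D :: "rat fps fps" where "D = (1 - var_x) ^ 2 - var_y * var_x ^ 2"
  have step: "D * choose_series c = (1 - var_x) * fps_const (fps_const (c 0)) +
      var_y * var_x ^ 2 * choose_series (\<lambda>k. c (Suc k) - c k)" for c
    unfolding D_def by (rule choose_series_step)
  have binom: "(\<lambda>k. of_nat (Suc (Suc k) choose Suc j) - of_nat (Suc k choose Suc j)) =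
      (\<lambda>k. of_nat (Suc k choose j) :: rat)" for j
    by (rule ext) simp
  define S where "S j = choose_series (\<lambda>k. of_nat (Suc k choose j))" for j
  have R0: "R0 = S 3"
    by (simp add: R0_def S_def choose_series_def r0_eq)
  have s3: "D * S 3 = var_y * var_x ^ 2 * S 2"
    using step[of "\<lambda>k. of_nat (Suc k choose 3)"] binom[of 2] by (simp add: S_def numeral_eq_Suc)
  have s2: "D * S 2 = var_y * var_x ^ 2 * S 1"
    using step[of "\<lambda>k. of_nat (Suc k choose 2)"] binom[of 1] by (simp add: S_def numeral_eq_Suc)
  have s1: "D * S 1 = (1 - var_x) + var_y * var_x ^ 2 * S 0"
    using step[of "\<lambda>k. of_nat (Suc k choose 1)"] binom[of 0] by (simp add: S_def)
  have zero: "choose_series (\<lambda>k. 0) = 0"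
    unfolding choose_series_def by (intro fps_ext) simp
  have s0: "D * S 0 = 1 - var_x"
    using step[of "\<lambda>k. of_nat (Suc k choose 0)"] by (simp add: S_def zero)
  have "D ^ 4 * S 3 = D ^ 3 * (D * S 3)" by (simp add: eval_nat_numeral algebra_simps)
  also have "\<dots> = var_y * var_x ^ 2 * (D ^ 2 * (D * S 2))"
    unfolding s3 by (simp add: eval_nat_numeral algebra_simps)
  also have "\<dots> = var_y ^ 2 * var_x ^ 4 * (D * (D * S 1))"
    unfolding s2 by (simp add: eval_nat_numeral algebra_simps)
  also have "D * (D * S 1) = (1 - var_x) * D + var_y * var_x ^ 2 * (D * S 0)"
    unfolding s1 by (simp add: algebra_simps)
  \<comment> \<open>Here D + y x^2 = (1 - x)^2 is used.\<close>
  also have "\<dots> = (1 - var_x) ^ 3"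
    unfolding s0 by (simp add: D_def eval_nat_numeral algebra_simps)
  finally have eq: "S 3 * D ^ 4 = var_y ^ 2 * var_x ^ 4 * (1 - var_x) ^ 3"
      by (simp add: mult.commute)
  \<comment> \<open>The coefficient ring is not a field. The constant coefficient 1 is what makes
    \<open>inverse (D ^ 4)\<close> a genuine inverse, and subdegree 0 reduces the division to
    multiplication by it.\<close>
  have unit: "fps_nth (D ^ 4) 0 = 1" by (simp add: D_def fps_power_zeroth power2_eq_square)
  have inv: "D ^ 4 * inverse (D ^ 4) = 1"
    unfolding fps_inverse_def by (rule fps_right_inverse) (simp add: unit fps_lr_inverse_one_one)
  have "subdegree (D ^ 4) = 0" unfolding subdegree_eq_0_iff unit by simp
  then have "(S 3 * D ^ 4) / D ^ 4 = S 3 * (D ^ 4 * inverse (D ^ 4))"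
    by (simp add: fps_divide_def mult.assoc)
  then have "(S 3 * D ^ 4) / D ^ 4 = S 3" unfolding inv by simp
  then show ?thesis unfolding eq by (simp add: R0 D_def)
qed

theorem theorem4p2:
  shows "(\<forall>n \<ge> 1. \<forall>k \<ge> 1. r0 n k = (n choose (2 * k)) * ((k + 1) choose 3)) \<and>
    R0 = (var_y ^ 2 * var_x ^ 4 * (1 - var_x) ^ 3) / ((1 - var_x) ^ 2 - var_y * var_x ^ 2) ^ 4"
  using r0_eq R0_eq by blast

end
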